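(* Let $G$ be a non-trivial periodic group with set of minimal subgroups $\Omega_G=\{H_i\}_{i\in I}$. Then $\mathcal A_G$ equipped with the multiplication $A\cdot B=\overline{[A][B]}$ becomes a group, and the mapping $\varphi:\mathcal A_G\to\Sigma(\mathcal K_1(G))$ defined by $\varphi(A)=[A]$ is an isomorphism.
   Context: For $K\le G$, $g\in G$ write $K^g=g^{-1}Kg$. $\mathcal K_1(G)$ is the set of all right cosets $Ha$ of all non-trivial subgroups $H$ of $G$ with operation $Ha*Kb=\langle H,K^{a^{-1}}\rangle ab$; it is an inverse semigroup whose idempotents are the non-trivial subgroups of $G$, with natural partial order $Ha\le_n Kb\iff Kb\subseteq Ha$, and with Green's relation $Ha\,\mathcal L\,Kb\iff H^a=K^b$. $L_H$ denotes the $\mathcal L$-class of $H$. In an inverse semigroup $S$, elements $x,y$ are compatible, $x\sim y$, if $xy^{-1}$ and $x^{-1}y$ are both idempotents. A subset of $S$ is permissible if its elements are pairwise compatible and it is an order ideal (down-set) for the natural partial order. The completion $C(S)$ is the set of all permissible subsets of $S$ under the usual multiplication of subsets; it is an inverse monoid with identity $E(S)$ (the set of idempotents of $S$). $\Sigma(S)$ denotes the group of units of $C(S)$. For $A\subseteq\mathcal K_1(G)$, $[A]$ is the order ideal generated by $A$ (all elements lying $\le_n$-below some element of $A$), and $\overline A$ is the set of maximal elements of $A$ with respect to $\le_n$. $[A][B]=\{x*y\mid x\in[A],y\in[B]\}$. Minimal subgroup means minimal non-trivial subgroup; the $H_i$ ($i\in I$) are pairwise distinct. $$\mathcal A_G=\{\{H_ia_i\}_{i\in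 I}\mid a_i\in G,\ (\forall j,k\in I)\ H_ja_j\sim H_ka_k\text{ and }|\{H_ia_i\}_{i\in I}\cap L_{H_j}|=1\}.$$ *)

theory Defs
  imports "HOL-Algebra.Coset" "HOL-Algebra.Generated_Groups"
begin

locale inverse_semigroup =
  fixes S :: "'s set" and mul :: "'s \<Rightarrow> 's \<Rightarrow> 's"  (infixl "\<cdot>" 70)
  assumes closed: "x \<in> S \<Longrightarrow> y \<in> S \<Longrightarrow> x \<cdot> y \<in> S"
    and assoc: "x \<in> S \<Longrightarrow> y \<in> S \<Longrightarrow> z \<in> S \<Longrightarrow> (x \<cdot> y) \<cdot> z = x \<cdot> (y \<cdot> z)"
    and unique_inverse: "x \<in> S \<Longrightarrow> \<exists>!y. y \<in> S \<and> x \<cdot> y \<cdot> x = x \<and> y \<cdot> x \<cdot> y = y"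
begin

definition inv_of :: "'s \<Rightarrow> 's"
  where "inv_of x = (THE y. y \<in> S \<and> x \<cdot> y \<cdot> x = x \<and> y \<cdot> x \<cdot> y = y)"

definition idempotents :: "'s set"
  where "idempotents = {e \<in> S. e \<cdot> e = e}"

definition nat_le :: "'s \<Rightarrow> 's \<Rightarrow> bool"
  where "nat_le x y \<longleftrightarrow> x \<in> S \<and> y \<in> S \<and> (\<exists>e \<in> idempotents. x = e \<cdot> y)"

definition left_ideal :: "'s \<Rightarrow> 's set"
  where "left_ideal x = insert x {s \<cdot> x | s. s \<in> S}"

definition L_class :: "'s \<Rightarrow> 's set"
  where "L_class x = {y \<in> S. left_ideal y = left_ideal x}"

definition compatible :: "'s \<Rightarrow> 's \<Rightarrow> bool"
  where "compatible x y \<longleftrightarrow> x \<cdot> inv_of y \<in> idempotents \<and> inv_of x \<cdot> y \<in> idempotents"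

definition set_mul :: "'s set \<Rightarrow> 's set \<Rightarrow> 's set"
  where "set_mul A B = {x \<cdot> y | x y. x \<in> A \<and> y \<in> B}"

definition down :: "'s set \<Rightarrow> 's set"
  where "down A = {x \<in> S. \<exists>y \<in> A. nat_le x y}"

definition maximals :: "'s set \<Rightarrow> 's set"
  where "maximals A = {x \<in> A. \<forall>y \<in> A. nat_le x y \<longrightarrow> y = x}"

(* The empty set is permissible; it is the zero of the completion and never a unit
   of it when S is non-empty. *)
definition permissible :: "'s set \<Rightarrow> bool"
  where "permissible A \<longleftrightarrow>
    A \<subseteq> S \<and> (\<forall>x \<in> A. \<forall>y \<in> A. compatible x y) \<and> (\<forall>x y. y \<in> A \<longrightarrow> nat_le x y \<longrightarrow> x \<in> A)"

definition completion :: "'s set monoid"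
  where "completion = \<lparr>carrier = {A. permissible A}, mult = set_mul, one = idempotents\<rparr>"

definition Sigma_group :: "'s set monoid"
  where "Sigma_group = units_of completion"

end

context group
begin

definition conj_sub :: "'a set \<Rightarrow> 'a \<Rightarrow> 'a set"
  where "conj_sub K g = (inv g <# K) #> g"

definition nontrivial_subgroup :: "'a set \<Rightarrow> bool"
  where "nontrivial_subgroup H \<longleftrightarrow> subgroup H G \<and> H \<noteq> {\<one>}"

(* K1_nat_le_iff and K1_L_iff below give the order and Green's relation L of the
   inverse semigroup of cosets explicitly: reverse inclusion, and equality of the
   conjugates of the two subgroups by their representatives. *)
definition K1 :: "'a set set"
  where "K1 = {H #> a | H a. nontrivial_subgroup H \<and> a \<in> carrier G}"

(* The product of two cosets is given through representatives; it does not depend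
   on them, see K1_mult_cosets. *)
definition K1_mult :: "'a set \<Rightarrow> 'a set \<Rightarrow> 'a set"
  where "K1_mult A B = (THE C. \<exists>H a K b.
    nontrivial_subgroup H \<and> a \<in> carrier G \<and> A = H #> a \<and>
    nontrivial_subgroup K \<and> b \<in> carrier G \<and> B = K #> b \<and>
    C = generate G (H \<union> conj_sub K (inv a)) #> (a \<otimes> b))"

definition minimal_subgroups :: "'a set set"
  where "minimal_subgroups = {H. nontrivial_subgroup H \<and>
    (\<forall>K. nontrivial_subgroup K \<longrightarrow> K \<subseteq> H \<longrightarrow> K = H)}"

lemma generate_superset: "A \<subseteq> generate G A"
  using generate.incl by (metis subsetI)

lemma cancel:
  "g \<in> carrier G \<Longrightarrow> x \<in> carrier G \<Longrightarrow> g \<otimes> (inv g \<otimes> x) = x"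
  "g \<in> carrier G \<Longrightarrow> x \<in> carrier G \<Longrightarrow> inv g \<otimes> (g \<otimes> x) = x"
  by (simp_all add: m_assoc[symmetric])

lemma r_coset_mono: "H \<subseteq> K \<Longrightarrow> H #> a \<subseteq> K #> a"
  unfolding r_coset_def by blast

lemma conj_sub_altdef: "conj_sub K g = {inv g \<otimes> k \<otimes> g | k. k \<in> K}"
  unfolding conj_sub_def r_coset_def l_coset_def by auto

lemma conj_sub_subgroup:
  assumes "subgroup K G" "g \<in> carrier G"
  shows "subgroup (conj_sub K g) G"
proof (rule subgroupI)
  note KG = subgroup.mem_carrier[OF assms(1)]
  show "conj_sub K g \<subseteq> carrier G" using KG assms(2) unfolding conj_sub_altdef by auto
  show "conj_sub K g \<noteq> {}" using subgroup.one_closed[OF assms(1)] unfolding conj_sub_altdef by auto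
  fix x assume "x \<in> conj_sub K g"
  then obtain k where k: "k \<in> K" "x = inv g \<otimes> k \<otimes> g" unfolding conj_sub_altdef by auto
  have "inv x = inv g \<otimes> inv k \<otimes> g" using k KG assms(2) by (simp add: inv_mult_group m_assoc)
  then show "inv x \<in> conj_sub K g" using subgroup.m_inv_closed[OF assms(1) k(1)]
    unfolding conj_sub_altdef by auto
  fix y assume "y \<in> conj_sub K g"
  then obtain l where l: "l \<in> K" "y = inv g \<otimes> l \<otimes> g" unfolding conj_sub_altdef by auto
  have "x \<otimes> y = inv g \<otimes> (k \<otimes> l) \<otimes> g"
    using k l KG assms(2) by (simp add: m_assoc cancel)
  then show "x \<otimes> y \<in> conj_sub K g" using subgroup.m_closed[OF assms(1) k(1) l(1)]
    unfolding conj_sub_altdef by auto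
qed

lemma nontrivial_mono:
  assumes "nontrivial_subgroup H" "subgroup L G" "H \<subseteq> L"
  shows "nontrivial_subgroup L"
  using assms subgroup.one_closed[of H G] unfolding nontrivial_subgroup_def by blast

lemma nontrivialD: "nontrivial_subgroup H \<Longrightarrow> subgroup H G"
  by (simp add: nontrivial_subgroup_def)

lemma K1I: "nontrivial_subgroup H \<Longrightarrow> a \<in> carrier G \<Longrightarrow> H #> a \<in> K1"
  unfolding K1_def by blast

lemma K1E:
  assumes "A \<in> K1"
  obtains H a where "nontrivial_subgroup H" "a \<in> carrier G" "A = H #> a"
  using assms unfolding K1_def by blast

lemma K1_carrier: "A \<in> K1 \<Longrightarrow> x \<in> A \<Longrightarrow> x \<in> carrier G"
  by (metis K1E nontrivialD r_coset_subset_G subgroup.subset subsetD)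

lemma join_subgroup:
  assumes "nontrivial_subgroup H" "nontrivial_subgroup K" "a \<in> carrier G"
  shows "nontrivial_subgroup (generate G (H \<union> conj_sub K a))"
proof -
  have sub: "H \<union> conj_sub K a \<subseteq> carrier G"
    using assms conj_sub_subgroup nontrivialD subgroup.subset by (metis Un_least)
  show ?thesis
    using nontrivial_mono[OF assms(1) generate_is_subgroup[OF sub]] generate_superset by fast
qed

lemma coset_subset_iff:
  assumes "subgroup H G" "subgroup K G" "a \<in> carrier G" "b \<in> carrier G"
  shows "H #> a \<subseteq> K #> b \<longleftrightarrow> a \<in> K #> b \<and> H \<subseteq> K"
proof
  assume sub: "H #> a \<subseteq> K #> b"
  have "a \<in> H #> a" using assms rcos_self by blast
  then have a: "a \<in> K #> b" using sub by blast
  then have eq: "K #> b = K #> a" using assms repr_independence by blast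
  have "h \<in> K" if "h \<in> H" for h
  proof -
    have "h \<otimes> a \<in> K #> a" using that sub eq unfolding r_coset_def by blast
    then obtain k where k: "k \<in> K" "h \<otimes> a = k \<otimes> a" unfolding r_coset_def by blast
    then have "h = k"
      using right_cancel that assms(3) subgroup.mem_carrier[OF assms(1)] subgroup.mem_carrier[OF assms(2)]
      by blast
    then show ?thesis using k by simp
  qed
  then show "a \<in> K #> b \<and> H \<subseteq> K" using a by blast
next
  assume r: "a \<in> K #> b \<and> H \<subseteq> K"
  then have eq: "K #> b = K #> a" using assms repr_independence by blast
  show "H #> a \<subseteq> K #> b" unfolding eq using r unfolding r_coset_def by blast
qed

lemma set_mult_cosets:
  assumes "subgroup H G" "subgroup K G" "a \<in> carrier G" "b \<in> carrier G"
  shows "(H #> a) <#> (K #> b) = (H <#> conj_sub K (inv a)) #> (a \<otimes> b)"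
proof -
  have eq: "h \<otimes> a \<otimes> (k \<otimes> b) = h \<otimes> (inv (inv a) \<otimes> k \<otimes> inv a) \<otimes> (a \<otimes> b)"
    if "h \<in> H" "k \<in> K" for h k
  proof -
    have c: "h \<in> carrier G" "k \<in> carrier G" using that assms subgroup.mem_carrier by metis+
    have "inv a \<otimes> (a \<otimes> b) = b" using assms by (simp add: m_assoc[symmetric])
    then show ?thesis using c assms by (simp add: m_assoc)
  qed
  show ?thesis
    unfolding set_mult_def r_coset_def conj_sub_altdef using eq by auto
qed

lemma join_subset_iff:
  assumes "nontrivial_subgroup H" "nontrivial_subgroup K" "a \<in> carrier G" "b \<in> carrier G" "D \<in> K1"
  shows "generate G (H \<union> conj_sub K (inv a)) #> (a \<otimes> b) \<subseteq> D \<longleftrightarrow> (H #> a) <#> (K #> b) \<subseteq> D"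
proof -
  obtain L d where D: "nontrivial_subgroup L" "d \<in> carrier G" "D = L #> d" using K1E[OF assms(5)] .
  let ?K = "conj_sub K (inv a)" and ?J = "generate G (H \<union> conj_sub K (inv a))"
  have sg: "subgroup H G" "subgroup K G" "subgroup L G" "subgroup ?K G"
    using assms D conj_sub_subgroup by (auto simp: nontrivial_subgroup_def)
  have J: "subgroup ?J G" using join_subgroup[OF assms(1,2)] assms(3) nontrivialD by simp
  have prod: "(H #> a) <#> (K #> b) = (H <#> ?K) #> (a \<otimes> b)"
    using set_mult_cosets sg assms by blast
  have ab: "a \<otimes> b \<in> carrier G" using assms by simp
  have HK: "H <#> ?K \<subseteq> ?J"
    unfolding set_mult_def using generate_superset[of "H \<union> ?K"] generate.eng by fastforce
  show ?thesis
  proof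
    assume "?J #> (a \<otimes> b) \<subseteq> D"
    then show "(H #> a) <#> (K #> b) \<subseteq> D" unfolding prod using r_coset_mono[OF HK, of "a \<otimes> b"] by (rule subset_trans[rotated])
  next
    assume sub: "(H #> a) <#> (K #> b) \<subseteq> D"
    have H1: "H \<subseteq> H <#> ?K" 
      using subgroup.one_closed[OF sg(4)] subgroup.mem_carrier[OF sg(1)]
      unfolding set_mult_def by force
    have K1: "?K \<subseteq> H <#> ?K" 
      using subgroup.one_closed[OF sg(1)] subgroup.mem_carrier[OF sg(4)]
      unfolding set_mult_def by force
    have "H #> (a \<otimes> b) \<subseteq> L #> d" "?K #> (a \<otimes> b) \<subseteq> L #> d"
      using sub r_coset_mono[OF H1, of "a \<otimes> b"] r_coset_mono[OF K1, of "a \<otimes> b"]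
      unfolding prod D(3) by (metis subset_trans)+
    then have "a \<otimes> b \<in> L #> d" "H \<union> ?K \<subseteq> L" using coset_subset_iff sg ab D(2) by auto
    then show "?J #> (a \<otimes> b) \<subseteq> D"
      using coset_subset_iff[OF J sg(3) ab D(2)] generate_subgroup_incl[OF _ sg(3)] D(3) by blast
  qed
qed

lemma K1_mult_cosets:
  assumes "nontrivial_subgroup H" "a \<in> carrier G" "nontrivial_subgroup K" "b \<in> carrier G"
  shows "K1_mult (H #> a) (K #> b) = generate G (H \<union> conj_sub K (inv a)) #> (a \<otimes> b)"
  unfolding K1_mult_def
proof (rule the_equality)
  show "\<exists>H' a' K' b'. nontrivial_subgroup H' \<and> a' \<in> carrier G \<and> H #> a = H' #> a' \<and>
    nontrivial_subgroup K' \<and> b' \<in> carrier G \<and> K #> b = K' #> b' \<and>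
    generate G (H \<union> conj_sub K (inv a)) #> (a \<otimes> b) =
    generate G (H' \<union> conj_sub K' (inv a')) #> (a' \<otimes> b')"
    using assms by blast
next
  fix C
  assume "\<exists>H' a' K' b'. nontrivial_subgroup H' \<and> a' \<in> carrier G \<and> H #> a = H' #> a' \<and>
    nontrivial_subgroup K' \<and> b' \<in> carrier G \<and> K #> b = K' #> b' \<and>
    C = generate G (H' \<union> conj_sub K' (inv a')) #> (a' \<otimes> b')"
  then obtain H' a' K' b' where
    c: "nontrivial_subgroup H'" "a' \<in> carrier G" "H #> a = H' #> a'"
    "nontrivial_subgroup K'" "b' \<in> carrier G" "K #> b = K' #> b'"
    "C = generate G (H' \<union> conj_sub K' (inv a')) #> (a' \<otimes> b')" by blast
  let ?C = "generate G (H \<union> conj_sub K (inv a)) #> (a \<otimes> b)"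
  have m: "C \<in> K1" "?C \<in> K1" using c assms by (auto intro!: K1I join_subgroup)
  note i1 = join_subset_iff[OF assms(1,3,2,4)] and i2 = join_subset_iff[OF c(1,4,2,5)]
  show "C = ?C" using i1[of C] i1[of ?C] i2[of C] i2[of ?C] m c by auto
qed

lemma K1_mult_closed: "A \<in> K1 \<Longrightarrow> B \<in> K1 \<Longrightarrow> K1_mult A B \<in> K1"
  by (elim K1E) (auto simp: K1_mult_cosets intro!: K1I join_subgroup)

lemma K1_mult_subset_iff:
  "A \<in> K1 \<Longrightarrow> B \<in> K1 \<Longrightarrow> D \<in> K1 \<Longrightarrow> K1_mult A B \<subseteq> D \<longleftrightarrow> A <#> B \<subseteq> D"
  by (elim K1E[of A] K1E[of B]) (simp add: K1_mult_cosets join_subset_iff)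

lemma set_mult_subset_K1_mult: "A \<in> K1 \<Longrightarrow> B \<in> K1 \<Longrightarrow> A <#> B \<subseteq> K1_mult A B"
  using K1_mult_subset_iff[of A B "K1_mult A B"] K1_mult_closed by blast

lemma K1_translate_right:
  assumes "D \<in> K1" "g \<in> carrier G"
  shows "{x \<in> carrier G. x \<otimes> g \<in> D} \<in> K1"
proof -
  obtain L d where D: "nontrivial_subgroup L" "d \<in> carrier G" "D = L #> d" using K1E[OF assms(1)] .
  have LG: "l \<in> carrier G" if "l \<in> L" for l
    using that D(1) nontrivialD subgroup.mem_carrier by metis
  have "{x \<in> carrier G. x \<otimes> g \<in> D} = L #> (d \<otimes> inv g)"
  proof (intro equalityI subsetI)
    fix x assume "x \<in> {x \<in> carrier G. x \<otimes> g \<in> D}"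
    then obtain l where l: "x \<in> carrier G" "l \<in> L" "x \<otimes> g = l \<otimes> d"
      using D(3) unfolding r_coset_def by auto
    then have "x = l \<otimes> (d \<otimes> inv g)"
      using LG D(2) assms(2) by (metis inv_solve_right m_assoc inv_closed m_closed)
    then show "x \<in> L #> (d \<otimes> inv g)" using l(2) unfolding r_coset_def by blast
  next
    fix x assume "x \<in> L #> (d \<otimes> inv g)"
    then obtain l where l: "l \<in> L" "x = l \<otimes> (d \<otimes> inv g)" unfolding r_coset_def by blast
    then have "x \<in> carrier G" "x \<otimes> g = l \<otimes> d" using LG D(2) assms(2) by (simp_all add: m_assoc)
    then show "x \<in> {x \<in> carrier G. x \<otimes> g \<in> D}" using l(1) D(3) unfolding r_coset_def by blast
  qed
  then show ?thesis using K1I D assms(2) by simp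
qed

lemma K1_translate_left:
  assumes "D \<in> K1" "g \<in> carrier G"
  shows "{x \<in> carrier G. g \<otimes> x \<in> D} \<in> K1"
proof -
  obtain L d where D: "nontrivial_subgroup L" "d \<in> carrier G" "D = L #> d" using K1E[OF assms(1)] .
  have LG: "l \<in> carrier G" if "l \<in> L" for l
    using that D(1) nontrivialD subgroup.mem_carrier by metis
  have nt: "nontrivial_subgroup (conj_sub L g)"
  proof -
    obtain l where l: "l \<in> L" "l \<noteq> \<one>"
      using D(1) subgroup.one_closed[of L G] unfolding nontrivial_subgroup_def by blast
    have "inv g \<otimes> l \<otimes> g \<noteq> \<one>"
    proof
      assume "inv g \<otimes> l \<otimes> g = \<one>"
      then have "g \<otimes> (inv g \<otimes> l \<otimes> g) \<otimes> inv g = \<one>" using assms(2) by simp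
      moreover have "g \<otimes> (inv g \<otimes> l \<otimes> g) \<otimes> inv g = l"
        using LG[OF l(1)] assms(2) by (simp add: m_assoc cancel)
      ultimately show False using l(2) by simp
    qed
    then show ?thesis
      using conj_sub_subgroup[OF nontrivialD[OF D(1)] assms(2)] l(1)
      unfolding nontrivial_subgroup_def conj_sub_altdef by blast
  qed
  have "{x \<in> carrier G. g \<otimes> x \<in> D} = conj_sub L g #> (inv g \<otimes> d)"
  proof (intro equalityI subsetI)
    fix x assume "x \<in> {x \<in> carrier G. g \<otimes> x \<in> D}"
    then obtain l where l: "x \<in> carrier G" "l \<in> L" "g \<otimes> x = l \<otimes> d"
      using D(3) unfolding r_coset_def by auto
    then have "x = inv g \<otimes> (l \<otimes> d)"
      using LG D(2) assms(2) by (metis inv_solve_left m_closed)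
    also have "\<dots> = inv g \<otimes> l \<otimes> g \<otimes> (inv g \<otimes> d)"
      using LG[OF l(2)] D(2) assms(2) by (simp add: m_assoc cancel)
    finally show "x \<in> conj_sub L g #> (inv g \<otimes> d)"
      using l(2) unfolding r_coset_def conj_sub_altdef by blast
  next
    fix x assume "x \<in> conj_sub L g #> (inv g \<otimes> d)"
    then obtain l where l: "l \<in> L" "x = inv g \<otimes> l \<otimes> g \<otimes> (inv g \<otimes> d)"
      unfolding r_coset_def conj_sub_altdef by blast
    have "inv g \<otimes> l \<otimes> g \<otimes> (inv g \<otimes> d) = inv g \<otimes> (l \<otimes> d)"
      using LG[OF l(1)] D(2) assms(2) by (simp add: m_assoc cancel)
    then have "x \<in> carrier G" "g \<otimes> x = l \<otimes> d"
      using LG[OF l(1)] D(2) assms(2) l(2) by (simp_all add: m_assoc cancel)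
    then show "x \<in> {x \<in> carrier G. g \<otimes> x \<in> D}" using l(1) D(3) unfolding r_coset_def by blast
  qed
  then show ?thesis using K1I nt D assms(2) by simp
qed

lemma K1_subset_carrier: "A \<in> K1 \<Longrightarrow> A \<subseteq> carrier G"
  using K1_carrier by blast

lemma K1_assoc_left_iff:
  assumes "A \<in> K1" "B \<in> K1" "C \<in> K1" "D \<in> K1"
  shows "K1_mult (K1_mult A B) C \<subseteq> D \<longleftrightarrow> (A <#> B) <#> C \<subseteq> D"
proof
  assume "K1_mult (K1_mult A B) C \<subseteq> D"
  then have "K1_mult A B <#> C \<subseteq> D"
    using K1_mult_subset_iff[OF K1_mult_closed[OF assms(1,2)] assms(3,4)] by blast
  then show "(A <#> B) <#> C \<subseteq> D"
    using set_mult_subset_K1_mult[OF assms(1,2)] unfolding set_mult_def by blast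
next
  assume sub: "(A <#> B) <#> C \<subseteq> D"
  have "x \<otimes> c \<in> D" if "c \<in> C" "x \<in> K1_mult A B" for c x
  proof -
    have c: "c \<in> carrier G" using that K1_carrier assms by blast
    have "A <#> B \<subseteq> {x \<in> carrier G. x \<otimes> c \<in> D}"
      using sub that(1) K1_subset_carrier[OF assms(1)] K1_subset_carrier[OF assms(2)]
      unfolding set_mult_def by blast
    then have "K1_mult A B \<subseteq> {x \<in> carrier G. x \<otimes> c \<in> D}"
      using K1_mult_subset_iff K1_translate_right assms c by blast
    then show ?thesis using that by blast
  qed
  then have "K1_mult A B <#> C \<subseteq> D" unfolding set_mult_def by blast
  then show "K1_mult (K1_mult A B) C \<subseteq> D"
    using K1_mult_subset_iff[OF K1_mult_closed[OF assms(1,2)] assms(3,4)] by blast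
qed

lemma K1_assoc_right_iff:
  assumes "A \<in> K1" "B \<in> K1" "C \<in> K1" "D \<in> K1"
  shows "K1_mult A (K1_mult B C) \<subseteq> D \<longleftrightarrow> A <#> (B <#> C) \<subseteq> D"
proof
  assume "K1_mult A (K1_mult B C) \<subseteq> D"
  then have "A <#> K1_mult B C \<subseteq> D"
    using K1_mult_subset_iff[OF assms(1) K1_mult_closed[OF assms(2,3)] assms(4)] by blast
  then show "A <#> (B <#> C) \<subseteq> D"
    using set_mult_subset_K1_mult[OF assms(2,3)] unfolding set_mult_def by blast
next
  assume sub: "A <#> (B <#> C) \<subseteq> D"
  have "a \<otimes> x \<in> D" if "a \<in> A" "x \<in> K1_mult B C" for a x
  proof -
    have a: "a \<in> carrier G" using that K1_carrier assms by blast
    have "B <#> C \<subseteq> {x \<in> carrier G. a \<otimes> x \<in> D}"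
      using sub that(1) K1_subset_carrier[OF assms(2)] K1_subset_carrier[OF assms(3)]
      unfolding set_mult_def by blast
    then have "K1_mult B C \<subseteq> {x \<in> carrier G. a \<otimes> x \<in> D}"
      using K1_mult_subset_iff K1_translate_left assms a by blast
    then show ?thesis using that by blast
  qed
  then have "A <#> K1_mult B C \<subseteq> D" unfolding set_mult_def by blast
  then show "K1_mult A (K1_mult B C) \<subseteq> D"
    using K1_mult_subset_iff[OF assms(1) K1_mult_closed[OF assms(2,3)] assms(4)] by blast
qed

lemma K1_mult_assoc:
  assumes "A \<in> K1" "B \<in> K1" "C \<in> K1"
  shows "K1_mult (K1_mult A B) C = K1_mult A (K1_mult B C)"
proof -
  have eq: "(A <#> B) <#> C = A <#> (B <#> C)"
    using assms set_mult_assoc K1_subset_carrier by blast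
  have m: "K1_mult (K1_mult A B) C \<in> K1" "K1_mult A (K1_mult B C) \<in> K1"
    using assms K1_mult_closed by blast+
  show ?thesis
    using K1_assoc_left_iff[OF assms] K1_assoc_right_iff[OF assms] m unfolding eq by blast
qed

lemma conj_sub_one: "subgroup K G \<Longrightarrow> conj_sub K \<one> = K"
  unfolding conj_sub_altdef using subgroup.mem_carrier by force

lemma generate_subgroup_id: "subgroup H G \<Longrightarrow> generate G H = H"
  using generate_subgroup_incl[of H H] generate_superset by blast

lemma nontrivial_in_K1: "nontrivial_subgroup H \<Longrightarrow> H \<in> K1"
  using K1I[of H \<one>] nontrivialD subgroup.subset by fastforce

lemma K1_mult_subgroup_coset:
  assumes "nontrivial_subgroup H" "nontrivial_subgroup K" "b \<in> carrier G"
  shows "K1_mult H (K #> b) = generate G (H \<union> K) #> b"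
proof -
  have "H #> \<one> = H" using coset_mult_one subgroup.subset[OF nontrivialD[OF assms(1)]] by simp
  then show ?thesis
    using K1_mult_cosets[OF assms(1) one_closed assms(2,3)] conj_sub_one[OF nontrivialD[OF assms(2)]]
      assms(3) by simp
qed

lemma K1_idem_iff: "A \<in> K1 \<Longrightarrow> K1_mult A A = A \<longleftrightarrow> nontrivial_subgroup A"
proof
  assume A: "A \<in> K1" "K1_mult A A = A"
  obtain H a where H: "nontrivial_subgroup H" "a \<in> carrier G" "A = H #> a" using K1E[OF A(1)] .
  have sH: "subgroup H G" using H nontrivialD by blast
  have aA: "a \<in> A" using rcos_self H sH by blast
  then have "a \<otimes> a \<in> A" using set_mult_subset_K1_mult[OF A(1) A(1)] A(2)
    unfolding set_mult_def by blast
  then obtain h where "h \<in> H" "a \<otimes> a = h \<otimes> a" using H(3) unfolding r_coset_def by auto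
  then have "a \<in> H" using H(2) sH subgroup.mem_carrier by fastforce
  then have "A = H" using H(3) sH by (metis coset_join2 H(2))
  then show "nontrivial_subgroup A" using H by simp
next
  assume A: "nontrivial_subgroup A"
  have e: "A #> \<one> = A" using coset_mult_one subgroup.subset[OF nontrivialD[OF A]] by simp
  show "K1_mult A A = A"
    using K1_mult_subgroup_coset[OF A A one_closed] generate_subgroup_id[OF nontrivialD[OF A]]
    by (simp add: e)
qed

lemma conj_sub_conj:
  assumes "subgroup K G" "g \<in> carrier G" "h \<in> carrier G"
  shows "conj_sub (conj_sub K g) h = conj_sub K (g \<otimes> h)"
proof -
  have "inv h \<otimes> (inv g \<otimes> k \<otimes> g) \<otimes> h = inv (g \<otimes> h) \<otimes> k \<otimes> (g \<otimes> h)" if "k \<in> K" for k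
    using that assms subgroup.mem_carrier[OF assms(1)] by (simp add: inv_mult_group m_assoc)
  then show ?thesis unfolding conj_sub_altdef setcompr_eq_image Collect_mem_eq image_image
    by (rule image_cong[OF refl])
qed

lemma conj_sub_nontrivial:
  assumes "nontrivial_subgroup L" "g \<in> carrier G"
  shows "nontrivial_subgroup (conj_sub L g)"
proof -
  have s: "subgroup L G" using assms nontrivialD by blast
  have "conj_sub {\<one>} (inv g) = {\<one>}" unfolding conj_sub_altdef using assms(2) by simp
  then have "conj_sub L g \<noteq> {\<one>}"
    using conj_sub_conj[OF s assms(2), of "inv g"] conj_sub_one[OF s] assms
    unfolding nontrivial_subgroup_def by auto
  then show ?thesis using conj_sub_subgroup[OF s assms(2)] unfolding nontrivial_subgroup_def by simp
qed

lemma K1_inverse: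
  assumes "nontrivial_subgroup H" "a \<in> carrier G"
  shows "K1_mult (H #> a) (conj_sub H a #> inv a) = H"
    and "K1_mult (conj_sub H a #> inv a) (H #> a) = conj_sub H a"
proof -
  have s: "subgroup H G" using assms nontrivialD by blast
  note c = conj_sub_nontrivial[OF assms]
  have *: "conj_sub (conj_sub H a) (inv a) = H"
    using conj_sub_conj[OF s assms(2), of "inv a"] assms(2) conj_sub_one[OF s] by simp
  show "K1_mult (H #> a) (conj_sub H a #> inv a) = H"
    using K1_mult_cosets[OF assms c, of "inv a"] assms(2) generate_subgroup_id[OF s]
      subgroup.subset[OF s] by (simp add: *)
  show "K1_mult (conj_sub H a #> inv a) (H #> a) = conj_sub H a"
    using K1_mult_cosets[OF c _ assms, of "inv a"] assms(2) generate_subgroup_id[OF nontrivialD[OF c]]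
      subgroup.subset[OF nontrivialD[OF c]] by simp
qed

lemma K1_regular:
  assumes "A \<in> K1"
  shows "\<exists>B \<in> K1. K1_mult (K1_mult A B) A = A \<and> K1_mult (K1_mult B A) B = B"
proof -
  obtain H a where H: "nontrivial_subgroup H" "a \<in> carrier G" "A = H #> a" using K1E[OF assms] .
  note c = conj_sub_nontrivial[OF H(1,2)]
  have "K1_mult H (H #> a) = H #> a"
    using K1_mult_subgroup_coset[OF H(1) H(1,2)] generate_subgroup_id[OF nontrivialD[OF H(1)]] by simp
  moreover have "K1_mult (conj_sub H a) (conj_sub H a #> inv a) = conj_sub H a #> inv a"
    using K1_mult_subgroup_coset[OF c c] H(2) generate_subgroup_id[OF nontrivialD[OF c]] by simp
  moreover have "conj_sub H a #> inv a \<in> K1" using K1I c H(2) by simp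
  ultimately show ?thesis using K1_inverse[OF H(1,2)] unfolding H(3)
    by (intro bexI[of _ "conj_sub H a #> inv a"]) simp_all
qed

lemma K1_idem_commute:
  assumes "nontrivial_subgroup A" "nontrivial_subgroup B"
  shows "K1_mult A B = K1_mult B A"
proof -
  have "A #> \<one> = A" "B #> \<one> = B" and J: "generate G (A \<union> B) \<subseteq> carrier G"
    using assms nontrivialD subgroup.subset coset_mult_one generate_incl by (metis Un_least)+
  then show ?thesis
    using K1_mult_subgroup_coset[OF assms one_closed] K1_mult_subgroup_coset[OF assms(2,1) one_closed]
    by (simp add: Un_commute)
qed

lemma K1_inverse_semigroup: "inverse_semigroup K1 K1_mult"
proof
  fix x assume x: "x \<in> K1"
  note as = K1_mult_assoc and cl = K1_mult_closed
  show "\<exists>!y. y \<in> K1 \<and> K1_mult (K1_mult x y) x = x \<and> K1_mult (K1_mult y x) y = y"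
  proof (rule ex_ex1I)
    show "\<exists>y. y \<in> K1 \<and> K1_mult (K1_mult x y) x = x \<and> K1_mult (K1_mult y x) y = y"
      using K1_regular[OF x] by blast
  next
    fix y z
    assume y: "y \<in> K1 \<and> K1_mult (K1_mult x y) x = x \<and> K1_mult (K1_mult y x) y = y"
      and z: "z \<in> K1 \<and> K1_mult (K1_mult x z) x = x \<and> K1_mult (K1_mult z x) z = z"
    have idem: "nontrivial_subgroup (K1_mult x w)" "nontrivial_subgroup (K1_mult w x)"
      if "w \<in> K1 \<and> K1_mult (K1_mult x w) x = x \<and> K1_mult (K1_mult w x) w = w" for w
      using that x K1_idem_iff as cl by metis+
    have "K1_mult y x = K1_mult (K1_mult y x) (K1_mult z x)" using x y z as cl by metis
    also have "\<dots> = K1_mult (K1_mult z x) (K1_mult y x)"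
      using K1_idem_commute idem(2)[OF y] idem(2)[OF z] by blast
    also have "\<dots> = K1_mult z x" using x y z as cl by metis
    finally have l: "K1_mult y x = K1_mult z x" .
    have "K1_mult x y = K1_mult (K1_mult x z) (K1_mult x y)" using x y z as cl by metis
    also have "\<dots> = K1_mult (K1_mult x y) (K1_mult x z)"
      using K1_idem_commute idem(1)[OF y] idem(1)[OF z] by blast
    also have "\<dots> = K1_mult x z" using x y z as cl by metis
    finally have r: "K1_mult x y = K1_mult x z" .
    show "y = z" using l r x y z as by metis
  qed
qed (fact K1_mult_closed K1_mult_assoc)+

end

sublocale group \<subseteq> K1: inverse_semigroup "group.K1 G" "group.K1_mult G"
  by (rule K1_inverse_semigroup)

context group
begin

lemma K1_idempotents: "K1.idempotents = {H. nontrivial_subgroup H}"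
  unfolding K1.idempotents_def using K1_idem_iff nontrivial_in_K1 by auto

lemma K1_nat_le_iff:
  assumes "A \<in> K1" "B \<in> K1"
  shows "K1.nat_le A B \<longleftrightarrow> B \<subseteq> A"
proof
  assume "K1.nat_le A B"
  then obtain E where E: "nontrivial_subgroup E" "A = K1_mult E B"
    unfolding K1.nat_le_def K1_idempotents by blast
  have "E <#> B \<subseteq> A" using E set_mult_subset_K1_mult nontrivial_in_K1 assms by simp
  moreover have "B \<subseteq> E <#> B"
    using subgroup.one_closed[OF nontrivialD[OF E(1)]] K1_subset_carrier[OF assms(2)]
    unfolding set_mult_def by force
  ultimately show "B \<subseteq> A" by blast
next
  assume sub: "B \<subseteq> A"
  obtain H a where H: "nontrivial_subgroup H" "a \<in> carrier G" "A = H #> a" using K1E[OF assms(1)] .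
  obtain K b where K: "nontrivial_subgroup K" "b \<in> carrier G" "B = K #> b" using K1E[OF assms(2)] .
  have s: "subgroup H G" "subgroup K G" using H K nontrivialD by blast+
  have bK: "b \<in> H #> a" "K \<subseteq> H"
    using coset_subset_iff[OF s(2,1) K(2) H(2)] sub H(3) K(3) by auto
  then have "A = H #> b" using repr_independence H(2,3) s by blast
  moreover have "K1_mult H B = generate G (H \<union> K) #> b"
    using K1_mult_subgroup_coset H K by simp
  moreover have "H \<union> K = H" using bK by blast
  ultimately have "A = K1_mult H B" using generate_subgroup_id[OF s(1)] by simp
  then show "K1.nat_le A B" unfolding K1.nat_le_def K1_idempotents using assms H(1) by blast
qed

lemma conj_sub_mono: "H \<subseteq> K \<Longrightarrow> conj_sub H g \<subseteq> conj_sub K g"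
  unfolding conj_sub_altdef by blast

lemma K1_L_subset:
  assumes "nontrivial_subgroup H" "a \<in> carrier G" "nontrivial_subgroup K" "b \<in> carrier G"
    and "H #> a \<in> K1.left_ideal (K #> b)"
  shows "conj_sub K b \<subseteq> conj_sub H a"
proof -
  have s: "subgroup H G" "subgroup K G" using assms nontrivialD by blast+
  have coset_conj: "A = H' #> x \<Longrightarrow> A = H'' #> y \<Longrightarrow> nontrivial_subgroup H' \<Longrightarrow> nontrivial_subgroup H''
    \<Longrightarrow> x \<in> carrier G \<Longrightarrow> y \<in> carrier G \<Longrightarrow> conj_sub H' x \<subseteq> conj_sub H'' y" for A H' H'' x y
  proof -
    assume A: "A = H' #> x" "A = H'' #> y" and nt: "nontrivial_subgroup H'" "nontrivial_subgroup H''"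
      and xy: "x \<in> carrier G" "y \<in> carrier G"
    have sg: "subgroup H' G" "subgroup H'' G" using nt nontrivialD by blast+
    have "x \<in> H'' #> y" "H' \<subseteq> H''"
      using coset_subset_iff[OF sg xy] A by auto
    then obtain h where h: "h \<in> H''" "x = h \<otimes> y" unfolding r_coset_def by blast
    have hG: "h \<in> carrier G" using h sg subgroup.mem_carrier by metis
    have "conj_sub H'' h \<subseteq> H''"
      unfolding conj_sub_altdef using h(1) sg(2)
      by (auto intro!: subgroup.m_closed subgroup.m_inv_closed)
    then have "conj_sub H'' x \<subseteq> conj_sub H'' y"
      using conj_sub_conj[OF sg(2) hG xy(2)] conj_sub_mono h(2) by metis
    then show ?thesis using conj_sub_mono[OF \<open>H' \<subseteq> H''\<close>] by blast
  qed
  show ?thesis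
  proof (cases "H #> a = K #> b")
    case True
    then show ?thesis using coset_conj[OF _ refl] assms by metis
  next
    case False
    then obtain C where C: "C \<in> K1" "H #> a = K1_mult C (K #> b)"
      using assms(5) unfolding K1.left_ideal_def by blast
    obtain L c where L: "nontrivial_subgroup L" "c \<in> carrier G" "C = L #> c" using K1E[OF C(1)] .
    let ?J = "generate G (L \<union> conj_sub K (inv c))"
    have J: "nontrivial_subgroup ?J" using join_subgroup L assms by simp
    have eq: "H #> a = ?J #> (c \<otimes> b)" using C L K1_mult_cosets assms by simp
    have "conj_sub K (inv c) \<subseteq> ?J" using generate_superset by fast
    then have "conj_sub (conj_sub K (inv c)) (c \<otimes> b) \<subseteq> conj_sub ?J (c \<otimes> b)" by (rule conj_sub_mono)
    moreover have "inv c \<otimes> (c \<otimes> b) = b" using L(2) assms(4) by (simp add: m_assoc[symmetric])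
    then have "conj_sub (conj_sub K (inv c)) (c \<otimes> b) = conj_sub K b"
      using conj_sub_conj[OF s(2), of "inv c" "c \<otimes> b"] L(2) assms(4) by simp
    moreover have "conj_sub ?J (c \<otimes> b) \<subseteq> conj_sub H a"
      using coset_conj[OF eq refl J assms(1)] coset_conj[OF eq[symmetric] refl] J assms L(2)
      by (metis coset_conj eq m_closed)
    ultimately show ?thesis by simp
  qed
qed

lemma K1_L_mem:
  assumes "nontrivial_subgroup H" "a \<in> carrier G" "nontrivial_subgroup K" "b \<in> carrier G"
    and "conj_sub H a = conj_sub K b"
  shows "K1.left_ideal (H #> a) \<subseteq> K1.left_ideal (K #> b)"
proof -
  have s: "subgroup H G" "subgroup K G" using assms nontrivialD by blast+
  have "conj_sub K (b \<otimes> inv a) = conj_sub (conj_sub H a) (inv a)"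
    using conj_sub_conj[OF s(2) assms(4), of "inv a"] assms by simp
  also have "\<dots> = H" using conj_sub_conj[OF s(1) assms(2), of "inv a"] conj_sub_one[OF s(1)] assms by simp
  finally have c: "conj_sub K (inv (a \<otimes> inv b)) = H" using assms by (simp add: inv_mult_group)
  let ?C = "H #> (a \<otimes> inv b)"
  have C: "?C \<in> K1" using K1I assms by simp
  have "K1_mult ?C (K #> b) = H #> a"
    using K1_mult_cosets[OF assms(1) _ assms(3,4), of "a \<otimes> inv b"] assms c generate_subgroup_id[OF s(1)]
    by (simp add: m_assoc)
  then have eq: "H #> a = K1_mult ?C (K #> b)" by simp
  have "K1_mult S (H #> a) = K1_mult (K1_mult S ?C) (K #> b)" if "S \<in> K1" for S
    using K1_mult_assoc[OF that C] K1I assms eq by metis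
  then show ?thesis
    unfolding K1.left_ideal_def using eq C K1_mult_closed by blast
qed

lemma K1_L_iff:
  assumes "nontrivial_subgroup H" "a \<in> carrier G" "nontrivial_subgroup K" "b \<in> carrier G"
  shows "H #> a \<in> K1.L_class (K #> b) \<longleftrightarrow> conj_sub H a = conj_sub K b"
proof
  assume "H #> a \<in> K1.L_class (K #> b)"
  then have "K1.left_ideal (H #> a) = K1.left_ideal (K #> b)" unfolding K1.L_class_def by simp
  then have "H #> a \<in> K1.left_ideal (K #> b)" "K #> b \<in> K1.left_ideal (H #> a)"
    unfolding K1.left_ideal_def by blast+
  then show "conj_sub H a = conj_sub K b" using K1_L_subset assms by (metis subset_antisym)
next
  assume "conj_sub H a = conj_sub K b"
  then show "H #> a \<in> K1.L_class (K #> b)"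
    using K1_L_mem[of H a K b] K1_L_mem[of K b H a] assms K1I unfolding K1.L_class_def by blast
qed

(* The record needs a neutral element, which the multiplication determines anyway:
   it is the member of the carrier with a i = 1 for all i. *)
definition A_group :: "'i set \<Rightarrow> ('i \<Rightarrow> 'a set) \<Rightarrow> 'a set set monoid"
  where "A_group I H = \<lparr>
    carrier = {A. \<exists>a \<in> I \<rightarrow> carrier G. A = {H i #> a i | i. i \<in> I} \<and>
      (\<forall>j \<in> I. \<forall>k \<in> I. K1.compatible (H j #> a j) (H k #> a k) \<and>
        card (A \<inter> K1.L_class (H j)) = 1)},
    mult = (\<lambda>A B. K1.maximals (K1.set_mul (K1.down A) (K1.down B))),
    one = {H i | i. i \<in> I}\<rparr>"

end

end

theory Submission
  imports Defs "HOL-Algebra.Multiplicative_Group"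
begin

text \<open>
  A permissible set \<open>U\<close> is a unit of the completion iff every idempotent occurs both as
  \<open>u u\<inverse>\<close> and as \<open>u\<inverse> u\<close> with \<open>u \<in> U\<close>; by compatibility such a \<open>u\<close> is unique. If every
  idempotent lies below a maximal one, then \<open>U\<close> is the order ideal of its maximal elements, and
  these are exactly the \<open>u\<close> with \<open>u u\<inverse>\<close> maximal, equivalently with \<open>u\<inverse> u\<close> maximal. So taking
  maximal elements and generating order ideals are inverse bijections between the units and the
  compatible sets on which \<open>u \<mapsto> u u\<inverse>\<close> and \<open>u \<mapsto> u\<inverse> u\<close> are bijections onto the maximal
  idempotents. In the semigroup of cosets the maximal idempotents are the minimal subgroups, and
  periodicity puts one inside every non-trivial subgroup.
\<close>

text \<open>Each group law holds in \<open>K\<close> after applying \<open>f\<close>, and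
  injectivity of \<open>f\<close> pulls it back; the inverse of \<open>x\<close> is the preimage of
  the inverse of \<open>f x\<close>. No law is presupposed for \<open>M\<close>, so the group
  structure and the isomorphism come together.\<close>

lemma bij_betw_group_transport:
  fixes M (structure)
  assumes "group K" and bij: "bij_betw f (carrier M) (carrier K)"
    and mult: "\<And>x y. x \<in> carrier M \<Longrightarrow> y \<in> carrier M \<Longrightarrow> x \<otimes> y \<in> carrier M \<and> f (x \<otimes> y) = f x \<otimes>\<^bsub>K\<^esub> f y"
    and one: "\<one> \<in> carrier M" "f \<one> = \<one>\<^bsub>K\<^esub>"
  shows "group M" and "f \<in> iso M K"
proof -
  interpret K: group K by fact
  have f: "f x \<in> carrier K" if "x \<in> carrier M" for x
    using that bij bij_betwE by blast
  have inj: "x = y" if "x \<in> carrier M" "y \<in> carrier M" "f x = f y" for x y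
    using that bij unfolding bij_betw_def inj_on_def by blast
  show "group M"
  proof (rule groupI)
    fix x assume x: "x \<in> carrier M"
    then obtain y where y: "y \<in> carrier M" "f y = inv\<^bsub>K\<^esub> f x"
      using bij f K.inv_closed unfolding bij_betw_def by (metis imageE)
    have "y \<otimes> x = \<one>" by (rule inj) (use x y mult one f in simp_all)
    then show "\<exists>y\<in>carrier M. y \<otimes> x = \<one>" using y by blast
    show "\<one> \<otimes> x = x" by (rule inj) (use x mult one f in simp_all)
    fix y z assume "y \<in> carrier M" "z \<in> carrier M"
    then show "x \<otimes> y \<otimes> z = x \<otimes> (y \<otimes> z)"
      by (intro inj) (use x mult f in \<open>simp_all add: K.m_assoc\<close>)
  qed (use mult one in blast)+
  show "f \<in> iso M K" unfolding iso_def hom_def using bij mult f by auto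
qed

section \<open>Inverses and idempotents\<close>

context inverse_semigroup
begin

lemma inv_of_props:
  assumes "x \<in> S"
  shows "inv_of x \<in> S" "x \<cdot> inv_of x \<cdot> x = x" "inv_of x \<cdot> x \<cdot> inv_of x = inv_of x"
  using theI'[OF unique_inverse[OF assms]] unfolding inv_of_def by auto

lemma inv_of_eqI:
  assumes "x \<in> S" "y \<in> S" "x \<cdot> y \<cdot> x = x" "y \<cdot> x \<cdot> y = y"
  shows "inv_of x = y"
  using inv_of_props[OF assms(1)] unique_inverse[OF assms(1)] assms by blast

lemma inv_of_inv_of: "x \<in> S \<Longrightarrow> inv_of (inv_of x) = x"
  by (rule inv_of_eqI) (simp_all add: inv_of_props)

text \<open>Right-associated forms of the inverse laws, also in front of a further factor
  \<open>z\<close>, so that together with \<open>assoc\<close> they work as rewrite rules.\<close>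

lemma inv_of_cancel:
  assumes "x \<in> S"
  shows "x \<cdot> (inv_of x \<cdot> x) = x" "inv_of x \<cdot> (x \<cdot> inv_of x) = inv_of x"
    and "z \<in> S \<Longrightarrow> x \<cdot> (inv_of x \<cdot> (x \<cdot> z)) = x \<cdot> z"
    and "z \<in> S \<Longrightarrow> inv_of x \<cdot> (x \<cdot> (inv_of x \<cdot> z)) = inv_of x \<cdot> z"
  using assms inv_of_props[OF assms] assoc closed by metis+

lemma idempotentD:
  assumes "e \<in> idempotents"
  shows "e \<in> S" "e \<cdot> e = e" "z \<in> S \<Longrightarrow> e \<cdot> (e \<cdot> z) = e \<cdot> z"
  using assms assoc[of e e z] unfolding idempotents_def by auto

lemma inv_of_idempotent: "e \<in> idempotents \<Longrightarrow> inv_of e = e"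
  by (rule inv_of_eqI) (simp_all add: idempotentD)

lemma inv_mul_idempotent:
  assumes "x \<in> S"
  shows "x \<cdot> inv_of x \<in> idempotents" "inv_of x \<cdot> x \<in> idempotents"
  unfolding idempotents_def using assms inv_of_props[OF assms] by (simp_all add: closed assoc inv_of_cancel)

text \<open>With \<open>x\<close> the inverse of \<open>e \<cdot> f\<close>, also
  \<open>f \<cdot> x \<cdot> e\<close> is an inverse of it. Uniqueness gives
  \<open>x = f \<cdot> x \<cdot> e\<close>, which makes \<open>x\<close> idempotent, hence its own
  inverse and equal to \<open>e \<cdot> f\<close>.\<close>

lemma idempotent_mul:
  assumes "e \<in> idempotents" "f \<in> idempotents"
  shows "e \<cdot> f \<in> idempotents"
proof -
  note e = idempotentD[OF assms(1)] and f = idempotentD[OF assms(2)]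
  define x where "x = inv_of (e \<cdot> f)"
  have ef: "e \<cdot> f \<in> S" using e f closed by blast
  have x: "x \<in> S" "e \<cdot> (f \<cdot> (x \<cdot> (e \<cdot> f))) = e \<cdot> f" "x \<cdot> (e \<cdot> (f \<cdot> x)) = x"
    using inv_of_props[OF ef] e f unfolding x_def by (simp_all add: closed assoc)
  have x': "x \<cdot> (e \<cdot> (f \<cdot> (x \<cdot> e))) = x \<cdot> e"
    using arg_cong[OF x(3), of "\<lambda>y. y \<cdot> e"] x(1) e(1) f(1) by (simp add: closed assoc)
  have "inv_of (e \<cdot> f) = f \<cdot> x \<cdot> e"
    by (rule inv_of_eqI) (simp_all add: ef x x' e f closed assoc)
  then have eq: "x = f \<cdot> (x \<cdot> e)" using x(1) e f by (simp add: x_def[symmetric] assoc)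
  have "x \<cdot> x = f \<cdot> (x \<cdot> e) \<cdot> (f \<cdot> (x \<cdot> e))" using eq by simp
  also have "\<dots> = f \<cdot> (x \<cdot> (e \<cdot> (f \<cdot> x)) \<cdot> e)" using x(1) e(1) f(1) by (simp add: closed assoc)
  also have "\<dots> = x" using x(3) eq by simp
  finally have "x \<in> idempotents" using x(1) unfolding idempotents_def by simp
  moreover have "e \<cdot> f = inv_of x" unfolding x_def using inv_of_inv_of[OF ef] by simp
  ultimately show ?thesis using inv_of_idempotent by simp
qed

text \<open>Both products are idempotent, so \<open>f \<cdot> e\<close> is an inverse of
  \<open>e \<cdot> f\<close>, whose inverse is itself.\<close>

lemma idempotent_commute:
  assumes "e \<in> idempotents" "f \<in> idempotents"
  shows "e \<cdot> f = f \<cdot> e"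
proof -
  note e = idempotentD[OF assms(1)] and f = idempotentD[OF assms(2)]
  have "e \<cdot> (f \<cdot> (e \<cdot> f)) = e \<cdot> f" "f \<cdot> (e \<cdot> (f \<cdot> e)) = f \<cdot> e"
    using idempotentD(2)[OF idempotent_mul[OF assms]]
      idempotentD(2)[OF idempotent_mul[OF assms(2,1)]] e f by (simp_all add: closed assoc)
  then have "inv_of (e \<cdot> f) = f \<cdot> e"
    by (intro inv_of_eqI) (simp_all add: e f closed assoc)
  then show ?thesis using inv_of_idempotent[OF idempotent_mul[OF assms]] by simp
qed

lemma idempotent_left_commute:
  assumes "e \<in> idempotents" "f \<in> idempotents" "z \<in> S"
  shows "e \<cdot> (f \<cdot> z) = f \<cdot> (e \<cdot> z)"
  using idempotent_commute[OF assms(1,2)] assms idempotentD(1) assoc by metis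

lemma inv_of_mul:
  assumes "x \<in> S" "y \<in> S"
  shows "inv_of (x \<cdot> y) = inv_of y \<cdot> inv_of x"
proof (rule inv_of_eqI)
  note i = inv_of_props(1)
  let ?e = "inv_of x \<cdot> x" and ?f = "y \<cdot> inv_of y"
  have ef: "?e \<in> idempotents" "?f \<in> idempotents" using inv_mul_idempotent assms by auto
  have "x \<cdot> y \<cdot> (inv_of y \<cdot> inv_of x) \<cdot> (x \<cdot> y) = x \<cdot> ((?f \<cdot> ?e) \<cdot> y)"
    using assms i by (simp add: closed assoc)
  also have "\<dots> = x \<cdot> ((?e \<cdot> ?f) \<cdot> y)" using idempotent_commute[OF ef] by simp
  also have "\<dots> = x \<cdot> y" using assms i by (simp add: closed assoc inv_of_cancel)
  finally show "x \<cdot> y \<cdot> (inv_of y \<cdot> inv_of x) \<cdot> (x \<cdot> y) = x \<cdot> y" .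
  have "inv_of y \<cdot> inv_of x \<cdot> (x \<cdot> y) \<cdot> (inv_of y \<cdot> inv_of x) = inv_of y \<cdot> ((?e \<cdot> ?f) \<cdot> inv_of x)"
    using assms i by (simp add: closed assoc)
  also have "\<dots> = inv_of y \<cdot> ((?f \<cdot> ?e) \<cdot> inv_of x)" using idempotent_commute[OF ef] by simp
  also have "\<dots> = inv_of y \<cdot> inv_of x" using assms i by (simp add: closed assoc inv_of_cancel)
  finally show "inv_of y \<cdot> inv_of x \<cdot> (x \<cdot> y) \<cdot> (inv_of y \<cdot> inv_of x) = inv_of y \<cdot> inv_of x" .
qed (use assms inv_of_props in \<open>auto intro: closed\<close>)

text \<open>An idempotent on the right of \<open>x\<close> can be moved to the left at the price of
  conjugation; this links the left-handed and right-handed descriptions of the natural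
  order.\<close>

lemma mul_idempotent:
  assumes "x \<in> S" "e \<in> idempotents"
  shows "x \<cdot> e = x \<cdot> e \<cdot> inv_of x \<cdot> x"
proof -
  have "x \<cdot> e = x \<cdot> ((inv_of x \<cdot> x) \<cdot> e)"
    using assms idempotentD inv_of_props by (simp add: closed assoc inv_of_cancel)
  also have "\<dots> = x \<cdot> (e \<cdot> (inv_of x \<cdot> x))"
    using idempotent_commute[OF inv_mul_idempotent(2)[OF assms(1)] assms(2)] by simp
  finally show ?thesis using assms idempotentD inv_of_props by (simp add: closed assoc)
qed

lemma conj_idempotent:
  assumes "x \<in> S" "e \<in> idempotents"
  shows "x \<cdot> e \<cdot> inv_of x \<in> idempotents"
proof -
  have "x \<cdot> e \<cdot> inv_of x \<cdot> (x \<cdot> e \<cdot> inv_of x) = (x \<cdot> e \<cdot> inv_of x \<cdot> x) \<cdot> (e \<cdot> inv_of x)"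
    using assms idempotentD inv_of_props by (simp add: closed assoc)
  also have "\<dots> = x \<cdot> e \<cdot> inv_of x"
    unfolding mul_idempotent[OF assms, symmetric]
    using assms idempotentD inv_of_props by (simp add: closed assoc)
  finally show ?thesis unfolding idempotents_def using assms idempotentD inv_of_props by (simp add: closed)
qed

text \<open>The product equals \<open>(x \<cdot> e \<cdot> inv_of x) \<cdot> (x \<cdot> y)\<close>,
  and both factors are idempotent. Compatibility of smaller elements and of products rests on
  this.\<close>

lemma mid_idempotent:
  assumes "x \<in> S" "y \<in> S" "e \<in> idempotents" "x \<cdot> y \<in> idempotents"
  shows "x \<cdot> e \<cdot> y \<in> idempotents"
proof -
  have "x \<cdot> e \<cdot> y = (x \<cdot> e \<cdot> inv_of x) \<cdot> (x \<cdot> y)"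
    using mul_idempotent[OF assms(1,3)] assms idempotentD inv_of_props by (simp add: closed assoc)
  then show ?thesis using idempotent_mul conj_idempotent assms by simp
qed

section \<open>The natural partial order\<close>

lemma nat_le_iff: "nat_le x y \<longleftrightarrow> x \<in> S \<and> y \<in> S \<and> x = x \<cdot> inv_of x \<cdot> y"
proof
  assume "nat_le x y"
  then obtain e where e: "x \<in> S" "y \<in> S" "e \<in> idempotents" "x = e \<cdot> y" unfolding nat_le_def by blast
  note eS = idempotentD[OF e(3)]
  have yy: "y \<cdot> inv_of y \<in> idempotents" using inv_mul_idempotent e by blast
  \<comment> \<open>Any witness \<open>e\<close> may be replaced by
    \<open>x \<cdot> inv_of x\<close>: in
    \<open>e \<cdot> y \<cdot> inv_of y \<cdot> e \<cdot> y\<close> the idempotents commute and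
    absorb each other.\<close>
  have "x \<cdot> inv_of x \<cdot> y = e \<cdot> (y \<cdot> inv_of y) \<cdot> (e \<cdot> y)"
    using e eS inv_of_props by (simp add: closed assoc inv_of_mul inv_of_idempotent)
  also have "\<dots> = e \<cdot> (e \<cdot> ((y \<cdot> inv_of y) \<cdot> y))"
    using e eS yy idempotent_left_commute[OF yy e(3,2)] idempotentD(1)[OF yy] by (simp only: closed assoc)
  also have "\<dots> = x" using e eS inv_of_props by (simp add: closed assoc)
  finally show "x \<in> S \<and> y \<in> S \<and> x = x \<cdot> inv_of x \<cdot> y" using e by simp
qed (use inv_mul_idempotent in \<open>auto simp: nat_le_def\<close>)

lemma nat_leI: "e \<in> idempotents \<Longrightarrow> y \<in> S \<Longrightarrow> nat_le (e \<cdot> y) y"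
  unfolding nat_le_def using idempotentD closed by blast

lemma nat_leI': "e \<in> idempotents \<Longrightarrow> y \<in> S \<Longrightarrow> nat_le (y \<cdot> e) y"
  using mul_idempotent[of y e] nat_leI[OF conj_idempotent[of y e], of y] by simp

lemma nat_leD: "nat_le x y \<Longrightarrow> x \<in> S" "nat_le x y \<Longrightarrow> y \<in> S"
  unfolding nat_le_def by auto

text \<open>The order is defined by idempotents on the left. Inverting
  \<open>x = e \<cdot> y\<close> puts \<open>e\<close> on the right, \<open>mul_idempotent\<close>
  moves it to the left, and inverting again leaves an idempotent on the right of
  \<open>y\<close>.\<close>

lemma nat_leE:
  assumes "nat_le x y"
  obtains e where "e \<in> idempotents" "x = y \<cdot> e"
proof -
  obtain e where e: "x \<in> S" "y \<in> S" "e \<in> idempotents" "x = e \<cdot> y"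
    using assms unfolding nat_le_def by blast
  have "inv_of x = inv_of y \<cdot> e"
    using e idempotentD by (simp add: inv_of_mul inv_of_idempotent)
  also have "\<dots> = (inv_of y \<cdot> e \<cdot> y) \<cdot> inv_of y"
    using mul_idempotent[of "inv_of y" e] e inv_of_props by (simp add: inv_of_inv_of)
  finally have "x = y \<cdot> inv_of (inv_of y \<cdot> e \<cdot> y)"
    using e inv_of_props idempotentD by (metis closed inv_of_inv_of inv_of_mul)
  moreover have "inv_of y \<cdot> e \<cdot> y \<in> idempotents"
    using conj_idempotent[of "inv_of y" e] e inv_of_props by (simp add: inv_of_inv_of)
  ultimately show ?thesis using that inv_of_idempotent by metis
qed

lemma nat_le_inv_of:
  assumes "nat_le x y"
  shows "nat_le (inv_of x) (inv_of y)"
proof -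
  obtain e where e: "e \<in> idempotents" "x = y \<cdot> e" using nat_leE[OF assms] .
  then show ?thesis using nat_leI[OF e(1), of "inv_of y"] nat_leD[OF assms] idempotentD inv_of_props
    by (simp add: inv_of_mul inv_of_idempotent)
qed

lemma nat_le_refl: "x \<in> S \<Longrightarrow> nat_le x x"
  unfolding nat_le_iff by (simp add: inv_of_props)

lemma nat_le_trans:
  assumes "nat_le x y" "nat_le y z"
  shows "nat_le x z"
proof -
  obtain e f where "e \<in> idempotents" "x = e \<cdot> y" "f \<in> idempotents" "y = f \<cdot> z"
    using assms unfolding nat_le_def by blast
  then show ?thesis using nat_leI[OF idempotent_mul, of e f z] nat_leD[OF assms(2)] idempotentD
    by (simp add: assoc)
qed

lemma nat_le_eq:
  assumes "nat_le x y" "x \<cdot> inv_of x = y \<cdot> inv_of y"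
  shows "x = y"
  using assms unfolding nat_le_iff by (simp add: inv_of_props)

text \<open>For \<open>x = e \<cdot> y\<close>, commuting idempotents give
  \<open>x \<cdot> inv_of x = e \<cdot> (y \<cdot> inv_of y)\<close>. The second claim is the first
  one for the inverses.\<close>

lemma nat_le_domain:
  assumes "nat_le x y"
  shows "nat_le (x \<cdot> inv_of x) (y \<cdot> inv_of y)" "nat_le (inv_of x \<cdot> x) (inv_of y \<cdot> y)"
proof -
  have *: "nat_le (x \<cdot> inv_of x) (y \<cdot> inv_of y)" if le: "nat_le x y" for x y
  proof -
    obtain e where e: "e \<in> idempotents" "x = e \<cdot> y" "y \<in> S" using le unfolding nat_le_def by blast
    note yy = inv_mul_idempotent(1)[OF e(3)]
    have "x \<cdot> inv_of x = (e \<cdot> (y \<cdot> inv_of y)) \<cdot> e"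
      using e idempotentD inv_of_props by (simp add: closed assoc inv_of_mul inv_of_idempotent)
    then have "x \<cdot> inv_of x = e \<cdot> (e \<cdot> (y \<cdot> inv_of y))"
      using idempotent_commute[OF idempotent_mul[OF e(1) yy] e(1)] by simp
    then show ?thesis using nat_leI[OF e(1) idempotentD(1)[OF yy]] idempotentD[OF e(1)]
        idempotentD(1)[OF yy] by simp
  qed
  show "nat_le (x \<cdot> inv_of x) (y \<cdot> inv_of y)" using *[OF assms] .
  show "nat_le (inv_of x \<cdot> x) (inv_of y \<cdot> y)"
    using *[OF nat_le_inv_of[OF assms]] nat_leD[OF assms] by (simp add: inv_of_inv_of)
qed

lemma nat_le_antisym:
  assumes "nat_le x y" "nat_le y x"
  shows "x = y"
proof -
  have *: "e = f" if ef: "e \<in> idempotents" "f \<in> idempotents" "nat_le e f" "nat_le f e" for e f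
    using ef idempotent_commute[OF ef(1,2)] unfolding nat_le_iff
    by (metis idempotentD(2) inv_of_idempotent)
  show ?thesis
    using nat_le_eq[OF assms(1)] *[OF _ _ nat_le_domain(1)[OF assms(1)] nat_le_domain(1)[OF assms(2)]]
      inv_mul_idempotent nat_leD[OF assms(1)] by blast
qed

lemma nat_le_idempotent_iff:
  assumes "e \<in> idempotents" "f \<in> idempotents"
  shows "nat_le e f \<longleftrightarrow> e \<cdot> f = e"
  unfolding nat_le_iff using assms idempotentD inv_of_idempotent by auto

section \<open>Compatible elements\<close>

lemma compatible_nat_le:
  assumes "x \<in> S" "y \<in> S" "inv_of x \<cdot> y \<in> idempotents" "nat_le (x \<cdot> inv_of x) (y \<cdot> inv_of y)"
  shows "nat_le x y"
proof -
  let ?w = "x \<cdot> inv_of x \<cdot> y"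
  note xx = inv_mul_idempotent(1)[OF assms(1)] and yy = inv_mul_idempotent(1)[OF assms(2)]
  have S: "x \<in> S" "y \<in> S" "inv_of x \<in> S" "inv_of y \<in> S" using assms inv_of_props by auto
  \<comment> \<open>\<open>?w\<close> is below \<open>x\<close> because
    \<open>inv_of x \<cdot> y\<close> is idempotent, and by the last hypothesis it has the same
    idempotent \<open>x \<cdot> inv_of x\<close>. Hence \<open>?w = x\<close>, which says that
    \<open>x\<close> is below \<open>y\<close>.\<close>
  have "?w \<cdot> inv_of ?w = (x \<cdot> inv_of x) \<cdot> (y \<cdot> inv_of y) \<cdot> (x \<cdot> inv_of x)"
    using S by (simp add: closed assoc inv_of_mul inv_of_inv_of)
  also have "\<dots> = x \<cdot> inv_of x"
    using assms(4) nat_le_idempotent_iff[OF xx yy] idempotentD(2)[OF xx] by simp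
  finally have "?w \<cdot> inv_of ?w = x \<cdot> inv_of x" .
  moreover have "nat_le ?w x" using nat_leI'[OF assms(3,1)] S by (simp add: assoc)
  ultimately have "?w = x" using nat_le_eq by blast
  then show ?thesis unfolding nat_le_iff using assms by simp
qed

lemma compatible_nat_le':
  assumes "x \<in> S" "y \<in> S" "x \<cdot> inv_of y \<in> idempotents" "nat_le (inv_of x \<cdot> x) (inv_of y \<cdot> y)"
  shows "nat_le x y"
  using nat_le_inv_of[OF compatible_nat_le[of "inv_of x" "inv_of y"]] assms inv_of_props
  by (simp add: inv_of_inv_of)

text \<open>If \<open>x \<cdot> inv_of x\<close> and \<open>y \<cdot> inv_of y\<close> agree, then
  \<open>x\<close> is below \<open>y\<close> by compatibility, with the same idempotent, hence equal
  to it. The other case is this one for the inverses.\<close>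

lemma compatible_domain_inj:
  assumes "x \<in> S" "y \<in> S" "compatible x y"
    and "x \<cdot> inv_of x = y \<cdot> inv_of y \<or> inv_of x \<cdot> x = inv_of y \<cdot> y"
  shows "x = y"
proof -
  have *: "x = y" if "x \<in> S" "y \<in> S" "inv_of x \<cdot> y \<in> idempotents" "x \<cdot> inv_of x = y \<cdot> inv_of y" for x y
    using that nat_le_eq[OF compatible_nat_le[OF that(1-3)]]
      nat_le_refl[OF idempotentD(1)[OF inv_mul_idempotent(1)[OF that(2)]]] by simp
  have "inv_of x = inv_of y" if "inv_of x \<cdot> x = inv_of y \<cdot> y"
    using *[of "inv_of x" "inv_of y"] that assms(1-3) inv_of_props(1)
    unfolding compatible_def by (simp add: inv_of_inv_of)
  then show ?thesis using * assms inv_of_inv_of unfolding compatible_def by metis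
qed

section \<open>Permissible sets and the completion\<close>

lemma down_permissible:
  assumes "A \<subseteq> S" "\<forall>x\<in>A. \<forall>y\<in>A. compatible x y"
  shows "permissible (down A)"
proof -
  have "compatible x y" if le: "nat_le x a" "nat_le y b" and m: "a \<in> A" "b \<in> A" for x y a b
  proof -
    have S: "a \<in> S" "b \<in> S" "inv_of a \<in> S" "inv_of b \<in> S" and
      c: "a \<cdot> inv_of b \<in> idempotents" "inv_of a \<cdot> b \<in> idempotents"
      using m assms inv_of_props unfolding compatible_def by auto
    \<comment> \<open>Witnesses on both sides are needed: \<open>g \<cdot> h\<close> lands between
      \<open>a\<close> and \<open>inv_of b\<close> in \<open>x \<cdot> inv_of y\<close>, while
      \<open>e \<cdot> f\<close> lands between \<open>inv_of a\<close> and \<open>b\<close> in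
      \<open>inv_of x \<cdot> y\<close>.\<close>
    obtain e f where ef: "e \<in> idempotents" "x = e \<cdot> a" "f \<in> idempotents" "y = f \<cdot> b"
      using le unfolding nat_le_def by blast
    obtain g h where gh: "g \<in> idempotents" "x = a \<cdot> g" "h \<in> idempotents" "y = b \<cdot> h"
      using nat_leE[OF le(1)] nat_leE[OF le(2)] by metis
    have "x \<cdot> inv_of y = a \<cdot> (g \<cdot> h) \<cdot> inv_of b"
      unfolding gh using S gh idempotentD by (simp add: closed assoc inv_of_mul inv_of_idempotent)
    moreover have "inv_of x \<cdot> y = inv_of a \<cdot> (e \<cdot> f) \<cdot> b"
      unfolding ef using S ef idempotentD by (simp add: closed assoc inv_of_mul inv_of_idempotent)
    ultimately show ?thesis unfolding compatible_def
      using mid_idempotent[OF _ _ idempotent_mul] S c ef gh by simp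
  qed
  then show ?thesis unfolding permissible_def down_def
    using nat_leD nat_le_trans by blast
qed

lemma permissibleD:
  assumes "permissible A" "x \<in> A"
  shows "x \<in> S" "y \<in> A \<Longrightarrow> compatible x y" "nat_le z x \<Longrightarrow> z \<in> A"
  using assms unfolding permissible_def by auto

lemma idempotents_permissible: "permissible idempotents"
  unfolding permissible_def compatible_def nat_le_def
  using idempotent_mul idempotentD inv_of_idempotent by auto

lemma set_mul_permissible:
  assumes "permissible A" "permissible B"
  shows "permissible (set_mul A B)"
proof -
  note A = permissibleD[OF assms(1)] and B = permissibleD[OF assms(2)]
  have "compatible (a \<cdot> b) (c \<cdot> d)" if m: "a \<in> A" "c \<in> A" "b \<in> B" "d \<in> B" for a b c d
  proof -
    have S: "a \<in> S" "b \<in> S" "c \<in> S" "d \<in> S" "inv_of a \<in> S" "inv_of b \<in> S" "inv_of c \<in> S" "inv_of d \<in> S"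
      using m A B inv_of_props by auto
    \<comment> \<open>Compatibility of one pair supplies an idempotent in the middle, compatibility
      of the other pair makes the outer product idempotent.\<close>
    have "a \<cdot> (b \<cdot> inv_of d) \<cdot> inv_of c \<in> idempotents" "inv_of b \<cdot> (inv_of a \<cdot> c) \<cdot> d \<in> idempotents"
      using mid_idempotent S A(2)[OF m(1,2)] B(2)[OF m(3,4)] unfolding compatible_def by blast+
    then show ?thesis unfolding compatible_def using S by (simp add: closed assoc inv_of_mul)
  qed
  moreover have "x \<in> set_mul A B" if m: "a \<in> A" "b \<in> B" "nat_le x (a \<cdot> b)" for x a b
  proof -
    obtain e where e: "e \<in> idempotents" "x = e \<cdot> (a \<cdot> b)" using m unfolding nat_le_def by blast
    then have "x = (e \<cdot> a) \<cdot> b" using m A(1) B(1) idempotentD by (simp add: assoc)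
    then show ?thesis unfolding set_mul_def using A(3)[OF m(1) nat_leI[OF e(1) A(1)[OF m(1)]]] m by blast
  qed
  moreover have "set_mul A B \<subseteq> S" unfolding set_mul_def using A(1) B(1) closed by blast
  ultimately show ?thesis unfolding permissible_def set_mul_def by blast
qed

text \<open>One inclusion holds as \<open>A\<close> is an order ideal, the other as
  \<open>a = a \<cdot> inv_of a \<cdot> a\<close>.\<close>

lemma set_mul_idempotents:
  assumes "permissible A"
  shows "set_mul idempotents A = A" "set_mul A idempotents = A"
proof -
  note A = permissibleD[OF assms]
  have "a = a \<cdot> inv_of a \<cdot> a" "a = a \<cdot> (inv_of a \<cdot> a)" if "a \<in> A" for a
    using A(1)[OF that] by (simp_all add: inv_of_props inv_of_cancel)
  then show "set_mul idempotents A = A" "set_mul A idempotents = A"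
    unfolding set_mul_def
    using A(1) A(3)[OF _ nat_leI] A(3)[OF _ nat_leI'] inv_mul_idempotent by fast+
qed

lemma set_mul_assoc:
  assumes "A \<subseteq> S" "B \<subseteq> S" "C \<subseteq> S"
  shows "set_mul (set_mul A B) C = set_mul A (set_mul B C)"
  unfolding set_mul_def using assms assoc by (auto, metis subsetD, metis subsetD)

lemma completion_monoid: "monoid completion"
proof
  fix x y z assume "x \<in> carrier completion" "y \<in> carrier completion" "z \<in> carrier completion"
  then show "x \<otimes>\<^bsub>completion\<^esub> y \<otimes>\<^bsub>completion\<^esub> z = x \<otimes>\<^bsub>completion\<^esub> (y \<otimes>\<^bsub>completion\<^esub> z)"
    unfolding completion_def using set_mul_assoc permissible_def by simp
qed (simp_all add: completion_def set_mul_permissible idempotents_permissible set_mul_idempotents)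

lemma inv_of_permissible:
  assumes "permissible A"
  shows "permissible (inv_of ` A)"
proof -
  note A = permissibleD[OF assms]
  have "compatible (inv_of a) (inv_of b)" if "a \<in> A" "b \<in> A" for a b
    using A(2)[OF that] A(1) that unfolding compatible_def by (simp add: inv_of_inv_of)
  moreover have "x \<in> inv_of ` A" if "a \<in> A" "nat_le x (inv_of a)" for a x
    using nat_le_inv_of[OF that(2)] that A(1,3) nat_leD(1) by (metis imageI inv_of_inv_of)
  ultimately show ?thesis unfolding permissible_def using A(1) inv_of_props by blast
qed

text \<open>For a unit, a factorisation of \<open>e\<close> exhibits some \<open>a\<close> whose
  idempotent lies above \<open>e\<close>, and cutting \<open>a\<close> down by \<open>e\<close>
  gives the required element. Conversely, the set of inverses inverts \<open>A\<close>:
  compatibility keeps the products idempotent, and the condition makes every idempotent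
  occur.\<close>

lemma completion_Units_iff:
  "A \<in> Units completion \<longleftrightarrow> permissible A \<and>
    (\<forall>e\<in>idempotents. (\<exists>a\<in>A. a \<cdot> inv_of a = e) \<and> (\<exists>a\<in>A. inv_of a \<cdot> a = e))"
proof
  assume "A \<in> Units completion"
  then obtain B where pA: "permissible A" and pB: "permissible B"
    and AB: "set_mul A B = idempotents" "set_mul B A = idempotents"
    unfolding Units_def completion_def by auto
  note A = permissibleD[OF pA] and B = permissibleD[OF pB]
  have "(\<exists>a\<in>A. a \<cdot> inv_of a = e) \<and> (\<exists>a\<in>A. inv_of a \<cdot> a = e)" if e: "e \<in> idempotents" for e
  proof
    note eS = idempotentD[OF e]
    obtain a b where ab: "a \<in> A" "b \<in> B" "e = a \<cdot> b" using AB(1) e unfolding set_mul_def by blast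
    have S: "a \<in> S" "b \<in> S" "inv_of a \<in> S" using ab A B inv_of_props by auto
    \<comment> \<open>Since \<open>e\<close> begins with the factor \<open>a\<close>, it lies below
      \<open>a \<cdot> inv_of a\<close>.\<close>
    have "(a \<cdot> inv_of a) \<cdot> e = e" unfolding ab(3) using S by (simp add: closed assoc inv_of_cancel)
    then have "(e \<cdot> a) \<cdot> inv_of (e \<cdot> a) = e"
      using S eS inv_of_idempotent[OF e] by (simp add: closed assoc inv_of_mul)
    then show "\<exists>a\<in>A. a \<cdot> inv_of a = e" using A(3)[OF ab(1) nat_leI[OF e S(1)]] by blast
    obtain a b where ab: "a \<in> A" "b \<in> B" "e = b \<cdot> a" using AB(2) e unfolding set_mul_def by blast
    have S: "a \<in> S" "b \<in> S" "inv_of a \<in> S" using ab A B inv_of_props by auto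
    have "e \<cdot> (inv_of a \<cdot> a) = e" unfolding ab(3) using S by (simp add: closed assoc inv_of_cancel)
    then have "(inv_of a \<cdot> a) \<cdot> e = e"
      using idempotent_commute[OF e inv_mul_idempotent(2)[OF S(1)]] by simp
    then have "inv_of (a \<cdot> e) \<cdot> (a \<cdot> e) = e"
      using S eS inv_of_idempotent[OF e] by (simp add: closed assoc inv_of_mul)
    then show "\<exists>a\<in>A. inv_of a \<cdot> a = e" using A(3)[OF ab(1) nat_leI'[OF e S(1)]] by blast
  qed
  then show "permissible A \<and> (\<forall>e\<in>idempotents. (\<exists>a\<in>A. a \<cdot> inv_of a = e) \<and> (\<exists>a\<in>A. inv_of a \<cdot> a = e))"
    using pA by blast
next
  assume r: "permissible A \<and> (\<forall>e\<in>idempotents. (\<exists>a\<in>A. a \<cdot> inv_of a = e) \<and> (\<exists>a\<in>A. inv_of a \<cdot> a = e))"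
  then have dr: "\<exists>a\<in>A. a \<cdot> inv_of a = e" "\<exists>a\<in>A. inv_of a \<cdot> a = e" if "e \<in> idempotents" for e
    using that by blast+
  have c: "a \<cdot> inv_of b \<in> idempotents" "inv_of a \<cdot> b \<in> idempotents" if "a \<in> A" "b \<in> A" for a b
    using permissibleD(2) r that unfolding compatible_def by blast+
  have "set_mul A (inv_of ` A) = idempotents" "set_mul (inv_of ` A) A = idempotents"
    unfolding set_mul_def using dr c by (fast, fast)
  then show "A \<in> Units completion"
    unfolding Units_def completion_def using r inv_of_permissible[of A] by auto
qed

section \<open>Compatible transversals of the maximal idempotents\<close>

text \<open>Both maps are automatically injective on \<open>A\<close>, by compatibility.\<close>

definition transversal :: "'s set \<Rightarrow> bool"
  where "transversal A \<longleftrightarrow> A \<subseteq> S \<and> (\<forall>x\<in>A. \<forall>y\<in>A. compatible x y) \<and>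
    (\<lambda>x. x \<cdot> inv_of x) ` A = maximals idempotents \<and> (\<lambda>x. inv_of x \<cdot> x) ` A = maximals idempotents"

text \<open>Modelled on \<open>A_group\<close> without the index family, so that the two records can
  be shown to be equal.\<close>

definition transversal_group :: "'s set monoid"
  where "transversal_group = \<lparr>carrier = {A. transversal A},
    mult = (\<lambda>A B. maximals (set_mul (down A) (down B))), one = maximals idempotents\<rparr>"

lemma maximals_idempotentsD:
  assumes "m \<in> maximals idempotents"
  shows "m \<in> idempotents" "e \<in> idempotents \<Longrightarrow> nat_le m e \<Longrightarrow> e = m"
  using assms unfolding maximals_def by auto

text \<open>If \<open>a\<close> is below \<open>b\<close> in a transversal, then
  \<open>a \<cdot> inv_of a\<close> is below \<open>b \<cdot> inv_of b\<close>; maximality makes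
  these equal, hence also \<open>a\<close> and \<open>b\<close>. So the members are pairwise
  incomparable.\<close>

lemma maximals_down_transversal:
  assumes "transversal A"
  shows "maximals (down A) = A"
proof -
  have A: "A \<subseteq> S" "\<forall>x\<in>A. \<forall>y\<in>A. compatible x y"
    "\<forall>x\<in>A. x \<cdot> inv_of x \<in> maximals idempotents"
    using assms unfolding transversal_def by auto
  have sub: "A \<subseteq> down A" unfolding down_def using A(1) nat_le_refl by blast
  have "a = x" if m: "a \<in> A" "x \<in> down A" "nat_le a x" for a x
  proof -
    obtain b where b: "b \<in> A" "nat_le x b" using m unfolding down_def by blast
    have le: "nat_le a b" using nat_le_trans m b by blast
    have "b \<cdot> inv_of b = a \<cdot> inv_of a"
      using maximals_idempotentsD(2)[OF _ _ nat_le_domain(1)[OF le]] A b m inv_mul_idempotent by blast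
    then have "a = b" using nat_le_eq[OF le] by simp
    then show ?thesis using nat_le_antisym m b by blast
  qed
  then show ?thesis
    unfolding maximals_def using sub by (auto simp: down_def)
qed

section \<open>Transversals correspond to units\<close>

context
  assumes below_maximal: "\<And>e. e \<in> idempotents \<Longrightarrow> \<exists>m\<in>maximals idempotents. nat_le e m"
begin

text \<open>Given \<open>e\<close> below a maximal \<open>m\<close>, the member \<open>a\<close>
  with \<open>a \<cdot> inv_of a = m\<close> is cut down to \<open>e \<cdot> a\<close>, the one with
  \<open>inv_of a \<cdot> a = m\<close> to \<open>a \<cdot> e\<close>.\<close>

lemma down_transversal_Units:
  assumes "transversal A"
  shows "down A \<in> Units completion"
proof -
  have A: "A \<subseteq> S" "\<forall>x\<in>A. \<forall>y\<in>A. compatible x y"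
    "(\<lambda>x. x \<cdot> inv_of x) ` A = maximals idempotents" "(\<lambda>x. inv_of x \<cdot> x) ` A = maximals idempotents"
    using assms unfolding transversal_def by auto
  have "(\<exists>a\<in>down A. a \<cdot> inv_of a = e) \<and> (\<exists>a\<in>down A. inv_of a \<cdot> a = e)" if e: "e \<in> idempotents" for e
  proof
    note eS = idempotentD[OF e]
    obtain m where m: "m \<in> maximals idempotents" "nat_le e m" using below_maximal[OF e] by blast
    have em: "e \<cdot> m = e" "m \<cdot> e = e"
      using m nat_le_idempotent_iff[OF e] idempotent_commute[OF e] maximals_idempotentsD(1) by auto
    obtain a where a: "a \<in> A" "m = a \<cdot> inv_of a" using m A(3) by blast
    have S: "a \<in> S" "inv_of a \<in> S" using a A inv_of_props by auto
    have "(e \<cdot> a) \<cdot> inv_of (e \<cdot> a) = e"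
      using S em eS inv_of_idempotent[OF e] unfolding a(2) by (simp add: closed assoc inv_of_mul)
    then show "\<exists>a\<in>down A. a \<cdot> inv_of a = e" 
      unfolding down_def using nat_leI[OF e S(1)] nat_leD a(1) by blast
    obtain a where a: "a \<in> A" "m = inv_of a \<cdot> a" using m A(4) by blast
    have S: "a \<in> S" "inv_of a \<in> S" using a A inv_of_props by auto
    have "inv_of (a \<cdot> e) \<cdot> (a \<cdot> e) = e"
      using S em eS inv_of_idempotent[OF e] unfolding a(2) by (simp add: closed assoc inv_of_mul)
    then show "\<exists>a\<in>down A. inv_of a \<cdot> a = e" 
      unfolding down_def using nat_leI'[OF e S(1)] nat_leD a(1) by blast
  qed
  then show ?thesis using completion_Units_iff down_permissible[OF A(1,2)] by blast
qed

lemma maximals_Units: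
  assumes "U \<in> Units completion"
  shows "transversal (maximals U)" "down (maximals U) = U"
proof -
  let ?M = "maximals idempotents"
  have pU: "permissible U"
    and dom: "\<And>e. e \<in> idempotents \<Longrightarrow> \<exists>u\<in>U. u \<cdot> inv_of u = e"
    and ran: "\<And>e. e \<in> idempotents \<Longrightarrow> \<exists>u\<in>U. inv_of u \<cdot> u = e"
    using assms unfolding completion_Units_iff by auto
  note U = permissibleD[OF pU]
  \<comment> \<open>Nothing in \<open>U\<close> is strictly above an element with a maximal
    idempotent on either side: a larger element has the same idempotent on that side, and
    compatibility identifies the two.\<close>
  have eqD: "x = y" if "x \<in> U" "y \<in> U" "nat_le x y" 
    "x \<cdot> inv_of x \<in> ?M \<or> inv_of x \<cdot> x \<in> ?M" for x y
  proof -
    have "y \<cdot> inv_of y = x \<cdot> inv_of x \<or> inv_of y \<cdot> y = inv_of x \<cdot> x"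
      using that(4) maximals_idempotentsD(2) nat_le_domain[OF that(3)] inv_mul_idempotent[OF U(1)[OF that(2)]]
      by blast
    then show ?thesis using compatible_domain_inj[OF U(1)[OF that(1)] U(1)[OF that(2)]] U(2) that by metis
  qed
  have max: "x \<in> maximals U" if "x \<in> U" "x \<cdot> inv_of x \<in> ?M \<or> inv_of x \<cdot> x \<in> ?M" for x
    unfolding maximals_def using that eqD[of x] by auto
  \<comment> \<open>The unit property realises a maximal idempotent above
    \<open>x \<cdot> inv_of x\<close> by some \<open>u\<close> in \<open>U\<close>, and
    compatibility lifts the comparison from the idempotents to \<open>x\<close> and
    \<open>u\<close>.\<close>
  have up1: "\<exists>u\<in>U. u \<cdot> inv_of u \<in> ?M \<and> nat_le x u" if x: "x \<in> U" for x
  proof -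
    obtain m where m: "m \<in> ?M" "nat_le (x \<cdot> inv_of x) m"
      using below_maximal inv_mul_idempotent U(1) x by blast
    then obtain u where u: "u \<in> U" "u \<cdot> inv_of u = m" using dom maximals_idempotentsD(1) by blast
    then show ?thesis using compatible_nat_le[of x u] U(1) U(2)[OF x u(1)] x m unfolding compatible_def by blast
  qed
  have up2: "\<exists>u\<in>U. inv_of u \<cdot> u \<in> ?M \<and> nat_le x u" if x: "x \<in> U" for x
  proof -
    obtain m where m: "m \<in> ?M" "nat_le (inv_of x \<cdot> x) m"
      using below_maximal inv_mul_idempotent U(1) x by blast
    then obtain u where u: "u \<in> U" "inv_of u \<cdot> u = m" using ran maximals_idempotentsD(1) by blast
    then show ?thesis using compatible_nat_le'[of x u] U(1) U(2)[OF x u(1)] x m unfolding compatible_def by blast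
  qed
  \<comment> \<open>A maximal \<open>x\<close> coincides with the elements above it from
    \<open>up1\<close> and \<open>up2\<close>, so both of its idempotents are maximal.\<close>
  have M: "x \<cdot> inv_of x \<in> ?M" "inv_of x \<cdot> x \<in> ?M" if "x \<in> maximals U" for x
    using that up1[of x] up2[of x] unfolding maximals_def by blast+
  have sub: "maximals U \<subseteq> U" unfolding maximals_def by blast
  have "(\<lambda>x. x \<cdot> inv_of x) ` maximals U = ?M"
    using M(1) max dom maximals_idempotentsD(1) by (auto simp: image_iff, metis)
  moreover have "(\<lambda>x. inv_of x \<cdot> x) ` maximals U = ?M"
    using M(2) max ran maximals_idempotentsD(1) by (auto simp: image_iff, metis)
  ultimately show "transversal (maximals U)" unfolding transversal_def using U(1,2) sub by blast
  show "down (maximals U) = U"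
    unfolding down_def using up1 max U(1,3) sub by blast
qed

lemma down_bij_betw:
  "bij_betw down {A. transversal A} (Units completion)"
  by (rule bij_betw_byWitness[where f' = maximals])
    (auto simp: maximals_down_transversal maximals_Units down_transversal_Units)

text \<open>A product of units is a unit, so it is generated by its maximal elements; hence
  \<open>down\<close> turns the product of transversals into the product of the order ideals.
  Likewise \<open>maximals idempotents\<close> generates \<open>idempotents\<close>, and the group
  structure is transported.\<close>

lemma transversal_group_iso:
  shows "group transversal_group" and "down \<in> iso transversal_group Sigma_group"
proof -
  have one: "idempotents \<in> Units completion"
    using monoid.Units_one_closed[OF completion_monoid] by (simp add: completion_def)
  show "group transversal_group" "down \<in> iso transversal_group Sigma_group"
    using bij_betw_group_transport[of Sigma_group down transversal_group]
      monoid.units_group[OF completion_monoid] down_bij_betw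
      maximals_Units one down_transversal_Units monoid.Units_m_closed[OF completion_monoid]
    by (simp_all add: Sigma_group_def units_of_def transversal_group_def completion_def)
qed

end

end

section \<open>The semigroup of cosets and its minimal subgroups\<close>

context group
begin

text \<open>As a set, the inverse is the left coset \<open>inv a <# H\<close>. The two idempotents
  of a coset are its stabilisers under left and right translation.\<close>

lemma K1_coset_inverse:
  assumes "nontrivial_subgroup H" "a \<in> carrier G"
  shows "K1.inv_of (H #> a) = conj_sub H a #> inv a"
    and "K1_mult (H #> a) (K1.inv_of (H #> a)) = H"
    and "K1_mult (K1.inv_of (H #> a)) (H #> a) = conj_sub H a"
proof -
  note c = conj_sub_nontrivial[OF assms]
  have "K1_mult H (H #> a) = H #> a"
    using K1_mult_subgroup_coset[OF assms(1) assms] generate_subgroup_id[OF nontrivialD[OF assms(1)]] by simp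
  moreover have "K1_mult (conj_sub H a) (conj_sub H a #> inv a) = conj_sub H a #> inv a"
    using K1_mult_subgroup_coset[OF c c] assms(2) generate_subgroup_id[OF nontrivialD[OF c]] by simp
  ultimately show inv: "K1.inv_of (H #> a) = conj_sub H a #> inv a"
    using K1_inverse[OF assms] K1I assms c by (intro K1.inv_of_eqI) simp_all
  show "K1_mult (H #> a) (K1.inv_of (H #> a)) = H"
    "K1_mult (K1.inv_of (H #> a)) (H #> a) = conj_sub H a"
    unfolding inv using K1_inverse[OF assms] by auto
qed

lemma K1_maximal_idempotents: "K1.maximals K1.idempotents = minimal_subgroups"
  unfolding K1.maximals_def K1_idempotents minimal_subgroups_def
  using K1_nat_le_iff nontrivial_in_K1 by auto

text \<open>Turns the condition on Green's relation in \<open>A_group\<close> into one on the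
  idempotent \<open>K1_mult (K1.inv_of x) x\<close>: for a coset of \<open>K\<close> by
  \<open>a\<close>, both sides say \<open>conj_sub K a = L\<close>.\<close>

lemma K1_L_class_subgroup_iff:
  assumes "x \<in> K1" "nontrivial_subgroup L"
  shows "x \<in> K1.L_class L \<longleftrightarrow> K1_mult (K1.inv_of x) x = L"
proof -
  obtain K a where K: "nontrivial_subgroup K" "a \<in> carrier G" "x = K #> a" using K1E[OF assms(1)] .
  have "L #> \<one> = L" using coset_mult_one subgroup.subset[OF nontrivialD[OF assms(2)]] by simp
  then show ?thesis
    using K1_L_iff[OF K(1,2) assms(2) one_closed] conj_sub_one[OF nontrivialD[OF assms(2)]]
    unfolding K(3) K1_coset_inverse(3)[OF K(1,2)] by simp
qed

text \<open>Conjugation by \<open>inv g\<close> carries subgroups of the conjugate back to subgroups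
  of \<open>L\<close>.\<close>

lemma conj_sub_minimal:
  assumes "L \<in> minimal_subgroups" "g \<in> carrier G"
  shows "conj_sub L g \<in> minimal_subgroups"
proof -
  have L: "nontrivial_subgroup L" using assms unfolding minimal_subgroups_def by blast
  have "K = conj_sub L g" if K: "nontrivial_subgroup K" "K \<subseteq> conj_sub L g" for K
  proof -
    have "conj_sub K (inv g) \<subseteq> L"
      using conj_sub_mono[OF K(2), of "inv g"] conj_sub_conj[OF nontrivialD[OF L], of g "inv g"]
        conj_sub_one[OF nontrivialD[OF L]] assms(2) by simp
    then have "conj_sub K (inv g) = L"
      using assms conj_sub_nontrivial[OF K(1)] unfolding minimal_subgroups_def by simp
    then show ?thesis
      using conj_sub_conj[OF nontrivialD[OF K(1)], of "inv g" g] conj_sub_one[OF nontrivialD[OF K(1)]]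
        assms(2) by simp
  qed
  then show ?thesis using conj_sub_nontrivial[OF L assms(2)] unfolding minimal_subgroups_def by simp
qed

text \<open>A non-trivial element of \<open>L\<close> generates a finite cyclic subgroup, among
  whose finitely many non-trivial subgroups one is minimal.\<close>

lemma periodic_contains_minimal:
  assumes "\<forall>x \<in> carrier G. \<exists>n::nat. n > 0 \<and> x [^] n = \<one>" "nontrivial_subgroup L"
  shows "\<exists>M \<in> minimal_subgroups. M \<subseteq> L"
proof -
  obtain x where x: "x \<in> L" "x \<noteq> \<one>"
    using assms(2) subgroup.one_closed unfolding nontrivial_subgroup_def by blast
  have xG: "x \<in> carrier G" using x assms(2) nontrivialD subgroup.mem_carrier by metis
  let ?C = "generate G {x}"
  have CL: "?C \<subseteq> L" using generate_subgroup_incl[OF _ nontrivialD[OF assms(2)]] x by simp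
  have "finite (carrier (subgroup_generated G {x}))"
    using finite_cyclic_subgroup[OF xG] assms(1) xG by blast
  then have fin: "finite ?C" using xG by (simp add: carrier_subgroup_generated)
  have "x \<in> ?C" using generate_superset by fastforce
  then have C: "nontrivial_subgroup ?C"
    unfolding nontrivial_subgroup_def using generate_is_subgroup xG x(2) by auto
  have "finite {K. nontrivial_subgroup K \<and> K \<subseteq> ?C}" using fin by simp
  then obtain M where M: "M \<in> {K. nontrivial_subgroup K \<and> K \<subseteq> ?C}"
    "\<forall>K \<in> {K. nontrivial_subgroup K \<and> K \<subseteq> ?C}. K \<subseteq> M \<longrightarrow> M = K"
    using finite_has_minimal[of "{K. nontrivial_subgroup K \<and> K \<subseteq> ?C}"] C by blast
  \<comment> \<open>Minimality inside \<open>?C\<close> is absolute: a subgroup of \<open>M\<close>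
    lies in \<open>?C\<close> as well.\<close>
  then have "M \<in> minimal_subgroups" unfolding minimal_subgroups_def by blast
  then show ?thesis using M(1) CL by blast
qed

section \<open>Families of cosets of minimal subgroups as transversals\<close>

lemma A_group_eq_transversal_group:
  assumes "bij_betw H I minimal_subgroups"
  shows "A_group I H = K1.transversal_group"
proof -
  let ?M = "K1.maximals K1.idempotents"
  have HI: "?M = H ` I" using assms K1_maximal_idempotents unfolding bij_betw_def by simp
  have H: "H i \<in> minimal_subgroups" "nontrivial_subgroup (H i)" if "i \<in> I" for i
    using that assms unfolding bij_betw_def minimal_subgroups_def by auto
  \<comment> \<open>The left idempotents are the \<open>H i\<close> by construction. The right ones
    are conjugates of minimal subgroups, hence minimal; that all minimal subgroups occur follows
    from the cardinality condition, as each class is met.\<close>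
  have "K1.transversal A" if a: "a \<in> I \<rightarrow> carrier G" and A: "A = {H i #> a i | i. i \<in> I}"
    and c: "\<And>j k. j \<in> I \<Longrightarrow> k \<in> I \<Longrightarrow> K1.compatible (H j #> a j) (H k #> a k) \<and>
        card (A \<inter> K1.L_class (H j)) = 1" for a A
  proof -
    have aG: "a i \<in> carrier G" if "i \<in> I" for i using a that by blast
    note inv = K1_coset_inverse[OF H(2) aG]
    have AK: "A \<subseteq> K1" unfolding A using K1I H aG by blast
    have "(\<lambda>x. K1_mult x (K1.inv_of x)) ` A = ?M"
      unfolding HI A using inv(2) by force
    moreover have "(\<lambda>x. K1_mult (K1.inv_of x) x) ` A = ?M"
    proof
      show "(\<lambda>x. K1_mult (K1.inv_of x) x) ` A \<subseteq> ?M"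
        unfolding A K1_maximal_idempotents using inv(3) conj_sub_minimal H aG by auto
      show "?M \<subseteq> (\<lambda>x. K1_mult (K1.inv_of x) x) ` A"
      proof
        fix m assume "m \<in> ?M"
        then obtain j where j: "j \<in> I" "m = H j" unfolding HI by blast
        then have "A \<inter> K1.L_class m \<noteq> {}" using c[of j j] by auto
        then obtain x where "x \<in> A" "x \<in> K1.L_class m" by blast
        then show "m \<in> (\<lambda>x. K1_mult (K1.inv_of x) x) ` A"
          using K1_L_class_subgroup_iff[of x m] AK j H(2) by blast
      qed
    qed
    moreover have "\<forall>x\<in>A. \<forall>y\<in>A. K1.compatible x y" unfolding A using c by blast
    ultimately show ?thesis unfolding K1.transversal_def using AK by blast
  qed
  moreover have "\<exists>a \<in> I \<rightarrow> carrier G. A = {H i #> a i | i. i \<in> I} \<and>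
      (\<forall>j \<in> I. \<forall>k \<in> I. K1.compatible (H j #> a j) (H k #> a k) \<and>
        card (A \<inter> K1.L_class (H j)) = 1)" if t: "K1.transversal A" for A
  proof -
    have A: "A \<subseteq> K1" "\<And>x y. x \<in> A \<Longrightarrow> y \<in> A \<Longrightarrow> K1.compatible x y"
      and dom: "(\<lambda>x. K1_mult x (K1.inv_of x)) ` A = H ` I"
      and ran: "(\<lambda>x. K1_mult (K1.inv_of x) x) ` A = H ` I"
      using t unfolding K1.transversal_def HI by auto
    have inj: "x = y" if "x \<in> A" "y \<in> A" "K1_mult x (K1.inv_of x) = K1_mult y (K1.inv_of y) \<or>
      K1_mult (K1.inv_of x) x = K1_mult (K1.inv_of y) y" for x y
      using that K1.compatible_domain_inj[of x y] A by blast
    \<comment> \<open>The left idempotent of a coset is its subgroup, so the member of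
      \<open>A\<close> with left idempotent \<open>H i\<close> is a coset of
      \<open>H i\<close>.\<close>
    have "\<exists>b. b \<in> carrier G \<and> H i #> b \<in> A" if i: "i \<in> I" for i
    proof -
      have "H i \<in> (\<lambda>x. K1_mult x (K1.inv_of x)) ` A" using dom i by blast
      then obtain x where x: "x \<in> A" "H i = K1_mult x (K1.inv_of x)" by blast
      obtain K b where K: "nontrivial_subgroup K" "b \<in> carrier G" "x = K #> b"
        using K1E x(1) A(1) by blast
      then show ?thesis using x K1_coset_inverse(2)[OF K(1,2)] by auto
    qed
    then obtain a where a: "\<And>i. i \<in> I \<Longrightarrow> a i \<in> carrier G \<and> H i #> a i \<in> A" by metis
    have "A = {H i #> a i | i. i \<in> I}"
    proof
      show "A \<subseteq> {H i #> a i | i. i \<in> I}"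
      proof
        fix x assume x: "x \<in> A"
        then obtain i where i: "i \<in> I" "K1_mult x (K1.inv_of x) = H i" using dom by blast
        then have "x = H i #> a i" using inj[OF x] a K1_coset_inverse(2)[OF H(2)] by metis
        then show "x \<in> {H i #> a i | i. i \<in> I}" using i by blast
      qed
    qed (use a in blast)
    moreover have "card (A \<inter> K1.L_class (H j)) = 1" if j: "j \<in> I" for j
    proof -
      have "H j \<in> (\<lambda>x. K1_mult (K1.inv_of x) x) ` A" using ran j by blast
      then obtain x where x: "x \<in> A" "H j = K1_mult (K1.inv_of x) x" by blast
      \<comment> \<open>Existence comes from surjectivity onto the maximal idempotents, uniqueness
        from compatibility.\<close>
      have "y \<in> K1.L_class (H j) \<longleftrightarrow> y = x" if "y \<in> A" for y
        using K1_L_class_subgroup_iff[OF subsetD[OF A(1) that] H(2)[OF j]] inj[OF that x(1)] x(2) by auto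
      then have "A \<inter> K1.L_class (H j) = {x}" using x(1) by blast
      then show ?thesis by simp
    qed
    ultimately show ?thesis using a A(2) by (intro bexI[of _ a]) auto
  qed
  ultimately have "carrier (A_group I H) = {A. K1.transversal A}"
    unfolding A_group_def by auto
  moreover have "{H i | i. i \<in> I} = ?M" unfolding HI by blast
  ultimately show ?thesis unfolding A_group_def K1.transversal_group_def by simp
qed

end

theorem lemma3p1:
  fixes G :: "('a, 'b) monoid_scheme" (structure)
    and I :: "'i set" and H :: "'i \<Rightarrow> 'a set"
  assumes "group G" and "carrier G \<noteq> {\<one>}"
    and "\<forall>x \<in> carrier G. \<exists>n::nat. n > 0 \<and> x [^] n = \<one>"
    and "bij_betw H I (group.minimal_subgroups G)"
  shows "group (group.A_group G I H) \<and>
    (\<lambda>A. inverse_semigroup.down (group.K1 G) (group.K1_mult G) A)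
      \<in> iso (group.A_group G I H)
            (inverse_semigroup.Sigma_group (group.K1 G) (group.K1_mult G))"
proof -
  interpret group G by fact
  \<comment> \<open>The order is reverse inclusion: a minimal subgroup inside \<open>e\<close> is a
    maximal idempotent above it.\<close>
  have "\<exists>m\<in>K1.maximals K1.idempotents. K1.nat_le e m" if e: "e \<in> K1.idempotents" for e
  proof -
    have nt: "nontrivial_subgroup e" using e K1_idempotents by blast
    then obtain M where M: "M \<in> minimal_subgroups" "M \<subseteq> e"
      using periodic_contains_minimal[OF assms(3)] by blast
    then have "K1.nat_le e M"
      using K1_nat_le_iff nontrivial_in_K1 nt unfolding minimal_subgroups_def by blast
    then show ?thesis using M(1) K1_maximal_idempotents by blast
  qed
  note K1.transversal_group_iso[OF this]
  then show ?thesis unfolding A_group_eq_transversal_group[OF assms(4)] by simp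
qed

end
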